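(* Let $f=(f_1,\ldots,f_m)$ be a contractive free holomorphic function with $\|f(0)\|<1$ such that the boundary functions $\widetilde f_1,\ldots,\widetilde f_m$ are in the noncommutative disc algebra $\mathcal A_n$. Then the map $$[\mathcal C_\infty]_{<1}\ni(T_1,\ldots,T_n)\mapsto f(T_1,\ldots,T_n)\in[\mathcal C_\infty]_{<1}$$ is continuous in the operator norm topology, where $[\mathcal C_\infty]_{<1}$ is the corresponding ball in $B(\mathcal H)^n$ and $B(\mathcal H)^m$, respectively.
   Context: Let $n,m\ge1$, $\mathcal H$ a complex Hilbert space, $\mathcal K$ a separable infinite-dimensional Hilbert space. $\mathbb F_n^+$ is the unital free semigroup on generators $g_1,\ldots,g_n$ with identity $g_0$; $|\alpha|$ is the length of $\alpha$. $X_\alpha:=X_{i_1}\cdots X_{i_k}$ if $\alpha=g_{i_1}\cdots g_{i_k}$, $X_{g_0}:=I$. For any number $n$ of operators, the joint spectral radius is $r(X):=\lim_{k\to\infty}\|\sum_{|\alpha|=k}X_\alpha X_\alpha^*\|^{1/2k}$ and $[\mathcal C_\infty]_{<1}$ is the set of tuples $X$ with $r(X)<1$. Tuples carry the norm $\|X\|=\|\sum_iX_iX_i^*\|^{1/2}$. $[B(\mathcal K)^n]_1:=\{X\in B(\mathcal K)^n:\|\sum_iX_iX_i^*\|<1\}$. Each $f_j(X)=\sum_{k=0}^\infty\sum_{|\alpha|=k}a_\alpha^{(j)}X_\alpha$ ($a^{(j)}_\alpha\in\mathbb C$, $\limsup_k(\sum_{|\alpha|=k}|a_\alpha^{(j)}|^2)^{1/2k}\le1$)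 is a free holomorphic function on $[B(\mathcal K)^n]_1$; $f$ is contractive if the row operator $[f_1(X)\ \cdots\ f_m(X)]$ has norm at most $1$ for all $X\in[B(\mathcal K)^n]_1$. $f(0)=(f_1(0),\ldots,f_m(0))$ has norm the Euclidean norm in $\mathbb C^m$. $S_i\varphi:=e_i\otimes\varphi$ are the left creation operators on the full Fock space $F^2(H_n)=\mathbb C1\oplus\bigoplus_{k\ge1}H_n^{\otimes k}$ ($e_1,\ldots,e_n$ an orthonormal basis of the $n$-dimensional Hilbert space $H_n$), and $\mathcal A_n$ is the norm closed algebra generated by $S_1,\ldots,S_n,I$. The boundary function of $f_j$ is $\widetilde f_j=\lim_{r\to1}f_j(rS_1,\ldots,rS_n)$; $\widetilde f_j\in\mathcal A_n$ means that this limit exists in operator norm. For $T$ with $r(T)<1$, $f(T)=(f_1(T),\ldots,f_m(T))$ with $f_j(T)=\sum_{k=0}^\infty\sum_{|\alpha|=k}a_\alpha^{(j)}T_\alpha$ (norm convergent in $k$). *)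

theory Defs
  imports "HOL-Analysis.Analysis"
begin

section \<open>Complex Hilbert spaces\<close>

text \<open>The norm, metric and topology are those of the real Hilbert space with inner product
  \<open>Re \<langle>x, y\<rangle>\<close>; the complex inner product is linear in the first argument.\<close>

class complex_hilbert = real_inner + complete_space +
  fixes scaleC :: "complex \<Rightarrow> 'a \<Rightarrow> 'a"  (infixr \<open>*\<^sub>C\<close> 75)
    and cinner :: "'a \<Rightarrow> 'a \<Rightarrow> complex"
  assumes scaleC_add_right: "c *\<^sub>C (x + y) = c *\<^sub>C x + c *\<^sub>C y"
    and scaleC_add_left: "(c + d) *\<^sub>C x = c *\<^sub>C x + d *\<^sub>C x"
    and scaleC_scaleC: "c *\<^sub>C d *\<^sub>C x = (c * d) *\<^sub>C x"
    and scaleC_of_real: "complex_of_real r *\<^sub>C x = r *\<^sub>R x"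
    and cinner_commute: "cinner x y = cnj (cinner y x)"
    and cinner_add_left: "cinner (x + y) z = cinner x z + cinner y z"
    and cinner_scaleC_left: "cinner (c *\<^sub>C x) y = c * cinner x y"
    and inner_eq_Re_cinner: "inner x y = Re (cinner x y)"

lemma cinner_self: "cinner x x = complex_of_real ((norm x)\<^sup>2)"
  for x :: "'a::complex_hilbert"
proof -
  have "Im (cinner x x) = 0"
    using cinner_commute[of x x] by (metis complex_cnj_cancel_iff cnj.sel(2) equal_neg_zero)
  then show ?thesis
    by (simp add: complex_eq_iff inner_eq_Re_cinner[symmetric] power2_norm_eq_inner)
qed

lemma norm_scaleC: "norm (c *\<^sub>C x) = cmod c * norm x"
  for x :: "'a::complex_hilbert"
proof -
  have "cinner (c *\<^sub>C x) (c *\<^sub>C x) = c * cnj (cinner (c *\<^sub>C x) x)"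
    by (metis cinner_commute cinner_scaleC_left)
  also have "\<dots> = (c * cnj c) * complex_of_real ((norm x)\<^sup>2)"
    by (simp add: cinner_scaleC_left cinner_self)
  also have "\<dots> = complex_of_real ((cmod c * norm x)\<^sup>2)"
    by (simp only: complex_norm_square[symmetric] of_real_mult[symmetric] power_mult_distrib)
  finally have "(norm (c *\<^sub>C x))\<^sup>2 = (cmod c * norm x)\<^sup>2"
    unfolding cinner_self of_real_eq_iff .
  then show ?thesis
    by (simp add: power2_eq_iff_nonneg)
qed

lemma bounded_linear_scaleC: "bounded_linear (\<lambda>x::'a::complex_hilbert. c *\<^sub>C x)"
proof (rule bounded_linear_intro[where K = "cmod c"])
  show "c *\<^sub>C r *\<^sub>R x = r *\<^sub>R c *\<^sub>C x" for r and x :: 'a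
    by (simp add: scaleC_of_real[symmetric] scaleC_scaleC mult.commute)
qed (simp_all add: scaleC_add_right norm_scaleC mult.commute)

definition separable_infinite_dimensional :: "'k::complex_hilbert itself \<Rightarrow> bool" where
  "separable_infinite_dimensional _ \<longleftrightarrow>
     separable_space (euclidean :: 'k topology) \<and>
     \<not> (\<exists>B :: 'k set. finite B \<and> (\<forall>x. \<exists>c. x = (\<Sum>b\<in>B. c b *\<^sub>C b)))"


section \<open>Bounded operators\<close>

text \<open>\<^typ>\<open>'h \<Rightarrow>\<^sub>L 'h\<close> is the space of bounded \<^emph>\<open>real\<close>-linear operators with the operator norm;
  \<open>B(H)\<close> is its subset \<open>complex_ops\<close>.\<close>

definition complex_ops :: "('h::complex_hilbert \<Rightarrow>\<^sub>L 'h) set" where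
  "complex_ops = {A. \<forall>c x. blinfun_apply A (c *\<^sub>C x) = c *\<^sub>C blinfun_apply A x}"

lift_definition scale_op ::
  "complex \<Rightarrow> ('h::complex_hilbert \<Rightarrow>\<^sub>L 'h) \<Rightarrow> ('h \<Rightarrow>\<^sub>L 'h)" is "\<lambda>c A x. c *\<^sub>C A x"
  by (rule bounded_linear_compose[OF bounded_linear_scaleC])

definition adjoint_op :: "('h::complex_hilbert \<Rightarrow>\<^sub>L 'h) \<Rightarrow> ('h \<Rightarrow>\<^sub>L 'h)" where
  "adjoint_op A = (THE B. \<forall>x y. cinner (blinfun_apply A x) y = cinner x (blinfun_apply B y))"

text \<open>Tuples of operators are indexed by a finite (automatically nonempty) type \<^typ>\<open>'n\<close>. Elements
  of the free semigroup on \<^typ>\<open>'n\<close> are lists, \<open>[]\<close> being the identity \<open>g\<^sub>0\<close>.\<close>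

primrec word_op :: "('n \<Rightarrow> 'h::complex_hilbert \<Rightarrow>\<^sub>L 'h) \<Rightarrow> 'n list \<Rightarrow> ('h \<Rightarrow>\<^sub>L 'h)" where
  "word_op X [] = id_blinfun"
| "word_op X (i # \<alpha>) = X i o\<^sub>L word_op X \<alpha>"

definition op_tuples :: "('n \<Rightarrow> 'h::complex_hilbert \<Rightarrow>\<^sub>L 'h) set" where
  "op_tuples = {X. \<forall>i. X i \<in> complex_ops}"

definition tuple_norm :: "('n::finite \<Rightarrow> 'h::complex_hilbert \<Rightarrow>\<^sub>L 'h) \<Rightarrow> real" where
  "tuple_norm X = sqrt (norm (\<Sum>i\<in>UNIV. X i o\<^sub>L adjoint_op (X i)))"

definition op_ball :: "('n::finite \<Rightarrow> 'h::complex_hilbert \<Rightarrow>\<^sub>L 'h) set" where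
  "op_ball = {X \<in> op_tuples. norm (\<Sum>i\<in>UNIV. X i o\<^sub>L adjoint_op (X i)) < 1}"

definition joint_spectral_radius :: "('n::finite \<Rightarrow> 'h::complex_hilbert \<Rightarrow>\<^sub>L 'h) \<Rightarrow> real" where
  "joint_spectral_radius X =
     lim (\<lambda>k. root (2 * k)
       (norm (\<Sum>\<alpha> | length \<alpha> = k. word_op X \<alpha> o\<^sub>L adjoint_op (word_op X \<alpha>))))"

definition spectral_ball :: "('n::finite \<Rightarrow> 'h::complex_hilbert \<Rightarrow>\<^sub>L 'h) set" where
  "spectral_ball = {X \<in> op_tuples. joint_spectral_radius X < 1}"

definition tuple_continuous_on ::
  "('n::finite \<Rightarrow> 'h::complex_hilbert \<Rightarrow>\<^sub>L 'h) set \<Rightarrow>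
   (('n \<Rightarrow> 'h \<Rightarrow>\<^sub>L 'h) \<Rightarrow> ('m::finite \<Rightarrow> 'h \<Rightarrow>\<^sub>L 'h)) \<Rightarrow> bool" where
  "tuple_continuous_on C F \<longleftrightarrow>
     (\<forall>T\<in>C. \<forall>\<epsilon>>0. \<exists>\<delta>>0. \<forall>T'\<in>C.
        tuple_norm (\<lambda>i. T' i - T i) < \<delta> \<longrightarrow> tuple_norm (\<lambda>j. F T' j - F T j) < \<epsilon>)"


section \<open>Free holomorphic functions\<close>

definition free_holomorphic :: "('n::finite list \<Rightarrow> complex) \<Rightarrow> bool" where
  "free_holomorphic a \<longleftrightarrow>
     limsup (\<lambda>k. ereal (root (2 * k) (\<Sum>\<alpha> | length \<alpha> = k. (cmod (a \<alpha>))\<^sup>2))) \<le> 1"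

text \<open>The outer series converges (or not) in the operator norm, grouped by word length.\<close>

definition free_eval ::
  "('n::finite list \<Rightarrow> complex) \<Rightarrow> ('n \<Rightarrow> 'h::complex_hilbert \<Rightarrow>\<^sub>L 'h) \<Rightarrow> ('h \<Rightarrow>\<^sub>L 'h)" where
  "free_eval a X = (\<Sum>k. \<Sum>\<alpha> | length \<alpha> = k. scale_op (a \<alpha>) (word_op X \<alpha>))"

definition free_map ::
  "('m \<Rightarrow> 'n::finite list \<Rightarrow> complex) \<Rightarrow> ('n \<Rightarrow> 'h::complex_hilbert \<Rightarrow>\<^sub>L 'h) \<Rightarrow> ('m \<Rightarrow> 'h \<Rightarrow>\<^sub>L 'h)" where
  "free_map a X = (\<lambda>j. free_eval (a j) X)"

text \<open>The row operator \<open>[F\<^sub>1 \<dots> F\<^sub>m]\<close> acts on the Hilbert direct sum \<^typ>\<open>'k ^ 'm\<close>.\<close>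

definition row_operator :: "('m::finite \<Rightarrow> 'k::complex_hilbert \<Rightarrow>\<^sub>L 'k) \<Rightarrow> 'k ^ 'm \<Rightarrow> 'k" where
  "row_operator F h = (\<Sum>j\<in>UNIV. blinfun_apply (F j) (h $ j))"

definition contractive ::
  "'k::complex_hilbert itself \<Rightarrow> ('m::finite \<Rightarrow> 'n::finite list \<Rightarrow> complex) \<Rightarrow> bool" where
  "contractive _ a \<longleftrightarrow>
     (\<forall>X \<in> (op_ball :: ('n \<Rightarrow> 'k \<Rightarrow>\<^sub>L 'k) set). onorm (row_operator (free_map a X)) \<le> 1)"

definition value_at_zero :: "('m::finite \<Rightarrow> 'n::finite list \<Rightarrow> complex) \<Rightarrow> complex ^ 'm" where
  "value_at_zero a = (\<chi> j. a j [])"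

text \<open>The operator \<open>f\<^sub>j(0)\<close> is the scalar \<open>value_at_zero a $ j\<close> times the identity.\<close>

lemma free_map_zero:
  "free_map a (\<lambda>i. 0 :: 'h::complex_hilbert \<Rightarrow>\<^sub>L 'h) j = scale_op (value_at_zero a $ j) id_blinfun"
proof -
  have w: "word_op (\<lambda>i. 0 :: 'h \<Rightarrow>\<^sub>L 'h) \<alpha> = (if \<alpha> = [] then id_blinfun else 0)" for \<alpha> :: "'n list"
    by (cases \<alpha>) auto
  have z: "scale_op c (0 :: 'h \<Rightarrow>\<^sub>L 'h) = 0" for c
    by (transfer, simp add: linear_simps[OF bounded_linear_scaleC])
  have "(\<Sum>\<alpha> | length \<alpha> = k. scale_op (a j \<alpha>) (word_op (\<lambda>i. 0 :: 'h \<Rightarrow>\<^sub>L 'h) \<alpha>)) =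
        (if k = 0 then scale_op (a j []) id_blinfun else 0)" for k
    by (cases k) (auto simp: w z intro!: sum.neutral)
  then have "free_eval (a j) (\<lambda>i. 0 :: 'h \<Rightarrow>\<^sub>L 'h) =
      (\<Sum>k. if k = 0 then scale_op (a j []) id_blinfun else 0)"
    by (simp add: free_eval_def)
  also have "\<dots> = scale_op (a j []) id_blinfun"
    by (subst suminf_finite[where N = "{0}"]) auto
  finally show ?thesis
    by (simp add: free_map_def value_at_zero_def)
qed


section \<open>The full Fock space\<close>

typedef 'a ell2 = "{f :: 'a \<Rightarrow> complex. (\<lambda>x. (cmod (f x))\<^sup>2) summable_on UNIV}"
  by (rule exI[of _ "\<lambda>_. 0"]) simp

setup_lifting type_definition_ell2

lemma ell2_product_summable:
  fixes f g :: "'a \<Rightarrow> complex"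
  assumes "(\<lambda>x. (cmod (f x))\<^sup>2) summable_on UNIV" "(\<lambda>x. (cmod (g x))\<^sup>2) summable_on UNIV"
  shows "(\<lambda>x. f x * cnj (g x)) summable_on UNIV"
proof -
  have "(\<lambda>x. norm (f x * cnj (g x))) summable_on UNIV"
    by (rule abs_summable_product) (use assms in \<open>simp_all add: norm_mult power2_eq_square\<close>)
  then show ?thesis
    by (rule abs_summable_summable)
qed

lemma ell2_product_commute:
  "(\<Sum>\<^sub>\<infinity>x. f x * cnj (g x)) = cnj (\<Sum>\<^sub>\<infinity>x. g x * cnj (f x))"
proof -
  have "(\<Sum>\<^sub>\<infinity>x. f x * cnj (g x)) = (\<Sum>\<^sub>\<infinity>x. cnj (g x * cnj (f x)))"
    by (rule infsum_cong) (simp add: mult.commute)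
  then show ?thesis
    by (simp only: infsum_cnj)
qed

lemma ell2_add_summable:
  fixes f g :: "'a \<Rightarrow> complex"
  assumes "(\<lambda>x. (cmod (f x))\<^sup>2) summable_on UNIV" "(\<lambda>x. (cmod (g x))\<^sup>2) summable_on UNIV"
  shows "(\<lambda>x. (cmod (f x + g x))\<^sup>2) summable_on UNIV"
proof (rule summable_on_comparison_test)
  show "(\<lambda>x. 2 * (cmod (f x))\<^sup>2 + 2 * (cmod (g x))\<^sup>2) summable_on UNIV"
    by (intro summable_on_add summable_on_cmult_right assms)
  fix x
  have "(cmod (f x + g x))\<^sup>2 \<le> (cmod (f x) + cmod (g x))\<^sup>2"
    by (intro power_mono norm_triangle_ineq) simp
  also have "\<dots> \<le> 2 * (cmod (f x))\<^sup>2 + 2 * (cmod (g x))\<^sup>2"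
    using sum_squares_bound[of "cmod (f x)" "cmod (g x)"] by (simp add: power2_sum)
  finally show "(cmod (f x + g x))\<^sup>2 \<le> 2 * (cmod (f x))\<^sup>2 + 2 * (cmod (g x))\<^sup>2" .
qed simp

lemma ell2_scale_summable:
  fixes f :: "'a \<Rightarrow> complex"
  assumes "(\<lambda>x. (cmod (f x))\<^sup>2) summable_on UNIV"
  shows "(\<lambda>x. (cmod (c * f x))\<^sup>2) summable_on UNIV"
  using summable_on_cmult_right[OF assms, of "(cmod c)\<^sup>2"]
  by (simp add: norm_mult power_mult_distrib)

instantiation ell2 :: (type) real_inner
begin

lift_definition zero_ell2 :: "'a ell2" is "\<lambda>_. 0"
  by simp

lift_definition plus_ell2 :: "'a ell2 \<Rightarrow> 'a ell2 \<Rightarrow> 'a ell2" is "\<lambda>f g x. f x + g x"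
  by (simp add: ell2_add_summable)

lift_definition uminus_ell2 :: "'a ell2 \<Rightarrow> 'a ell2" is "\<lambda>f x. - f x"
  by simp

lift_definition minus_ell2 :: "'a ell2 \<Rightarrow> 'a ell2 \<Rightarrow> 'a ell2" is "\<lambda>f g x. f x - g x"
  using ell2_add_summable[where g = "\<lambda>x. - g x" for g] by simp

lift_definition scaleR_ell2 :: "real \<Rightarrow> 'a ell2 \<Rightarrow> 'a ell2" is "\<lambda>r f x. complex_of_real r * f x"
  using ell2_scale_summable by auto

lift_definition inner_ell2 :: "'a ell2 \<Rightarrow> 'a ell2 \<Rightarrow> real" is
  "\<lambda>f g. Re (\<Sum>\<^sub>\<infinity>x. f x * cnj (g x))" .

definition norm_ell2 :: "'a ell2 \<Rightarrow> real" where "norm_ell2 f = sqrt (inner f f)"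

definition dist_ell2 :: "'a ell2 \<Rightarrow> 'a ell2 \<Rightarrow> real" where "dist_ell2 f g = norm (f - g)"

definition sgn_ell2 :: "'a ell2 \<Rightarrow> 'a ell2" where "sgn_ell2 f = inverse (norm f) *\<^sub>R f"

definition uniformity_ell2 :: "('a ell2 \<times> 'a ell2) filter" where
  "uniformity_ell2 = (INF e\<in>{0<..}. principal {(x, y). dist x y < e})"

definition open_ell2 :: "'a ell2 set \<Rightarrow> bool" where
  "open_ell2 U \<longleftrightarrow> (\<forall>x\<in>U. \<forall>\<^sub>F (x', y) in uniformity. x' = x \<longrightarrow> y \<in> U)"

lemma inner_ell2_self: "inner f f = (\<Sum>\<^sub>\<infinity>x. (cmod (Rep_ell2 f x))\<^sup>2)" for f :: "'a ell2"
proof -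
  have *: "(\<lambda>x. Rep_ell2 f x * cnj (Rep_ell2 f x)) summable_on UNIV"
    by (rule ell2_product_summable) (use Rep_ell2[of f] in auto)
  have "inner f f = (\<Sum>\<^sub>\<infinity>x. Re (Rep_ell2 f x * cnj (Rep_ell2 f x)))"
    by (simp only: inner_ell2.rep_eq infsum_Re[OF *])
  also have "\<dots> = (\<Sum>\<^sub>\<infinity>x. (cmod (Rep_ell2 f x))\<^sup>2)"
    by (rule infsum_cong) (simp only: complex_norm_square[symmetric] Re_complex_of_real)
  finally show ?thesis .
qed

instance
proof
  fix f g h :: "'a ell2" and r s :: real
  show "f + g + h = f + (g + h)" by transfer (simp add: algebra_simps)
  show "f + g = g + f" by transfer (simp add: algebra_simps)
  show "0 + f = f" by transfer simp
  show "- f + f = 0" by transfer simp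
  show "f - g = f + - g" by transfer simp
  show "r *\<^sub>R (f + g) = r *\<^sub>R f + r *\<^sub>R g" by transfer (simp add: algebra_simps)
  show "(r + s) *\<^sub>R f = r *\<^sub>R f + s *\<^sub>R f" by transfer (simp add: algebra_simps)
  show "r *\<^sub>R s *\<^sub>R f = (r * s) *\<^sub>R f" by transfer (simp add: mult.assoc)
  show "1 *\<^sub>R f = f" by transfer simp
  show "sgn f = inverse (norm f) *\<^sub>R f" by (rule sgn_ell2_def)
  show "dist f g = norm (f - g)" by (rule dist_ell2_def)
  show "(uniformity :: ('a ell2 \<times> 'a ell2) filter) =
      (INF e\<in>{0<..}. principal {(x, y). dist x y < e})" by (rule uniformity_ell2_def)
  show "open U \<longleftrightarrow> (\<forall>x\<in>U. \<forall>\<^sub>F (x', y) in uniformity. x' = x \<longrightarrow> y \<in> U)" for U :: "'a ell2 set"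
    by (rule open_ell2_def)
  show "norm f = sqrt (inner f f)" by (rule norm_ell2_def)
  show "inner f g = inner g f"
    by transfer (metis ell2_product_commute cnj.sel(1))
  show "inner (f + g) h = inner f h + inner g h"
    by transfer (simp add: distrib_right infsum_add ell2_product_summable)
  show "inner (r *\<^sub>R f) g = r * inner f g"
    by transfer (simp add: mult.assoc infsum_cmult_right')
  show "0 \<le> inner f f"
    unfolding inner_ell2_self by (rule infsum_nonneg) simp
  show "inner f f = 0 \<longleftrightarrow> f = 0"
  proof
    assume "inner f f = 0"
    then have "(cmod (Rep_ell2 f x))\<^sup>2 = 0" for x
      using nonneg_infsum_le_0D[of "\<lambda>x. (cmod (Rep_ell2 f x))\<^sup>2" UNIV x] Rep_ell2[of f]
      by (simp add: inner_ell2_self)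
    then show "f = 0"
      by transfer (auto simp: fun_eq_iff)
  qed (simp add: inner_ell2_self zero_ell2.rep_eq)
qed

end

lemma norm_ell2_sq: "(norm f)\<^sup>2 = (\<Sum>\<^sub>\<infinity>x. (cmod (Rep_ell2 f x))\<^sup>2)"
  by (simp add: power2_norm_eq_inner inner_ell2_self)

lemma ell2_finite_sum_le: "finite F \<Longrightarrow> (\<Sum>x\<in>F. (cmod (Rep_ell2 f x))\<^sup>2) \<le> (norm f)\<^sup>2"
  unfolding norm_ell2_sq by (rule finite_sum_le_infsum) (use Rep_ell2[of f] in auto)

lemma ell2_component_le: "cmod (Rep_ell2 f x) \<le> norm f"
  using ell2_finite_sum_le[of "{x}" f] by (simp add: power2_le_iff_abs_le)

instance ell2 :: (type) complete_space
proof
  fix X :: "nat \<Rightarrow> 'a ell2"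
  assume X: "Cauchy X"
  have "Cauchy (\<lambda>n. Rep_ell2 (X n) x)" for x
  proof (rule metric_CauchyI)
    fix e :: real
    assume "e > 0"
    then obtain N where N: "\<And>m n. m \<ge> N \<Longrightarrow> n \<ge> N \<Longrightarrow> dist (X m) (X n) < e"
      using metric_CauchyD[OF X] by blast
    have "dist (Rep_ell2 (X m) x) (Rep_ell2 (X n) x) \<le> dist (X m) (X n)" for m n
      using ell2_component_le[of "X m - X n" x] by (simp add: dist_norm minus_ell2.rep_eq)
    then show "\<exists>N. \<forall>m\<ge>N. \<forall>n\<ge>N. dist (Rep_ell2 (X m) x) (Rep_ell2 (X n) x) < e"
      using N by (blast intro: le_less_trans)
  qed
  then have "\<exists>l. (\<lambda>n. Rep_ell2 (X n) x) \<longlonglongrightarrow> l" for x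
    by (simp add: Cauchy_convergent_iff convergent_def)
  then have "\<exists>g. \<forall>x. (\<lambda>n. Rep_ell2 (X n) x) \<longlonglongrightarrow> g x"
    by (intro choice allI)
  then obtain g where g: "\<And>x. (\<lambda>n. Rep_ell2 (X n) x) \<longlonglongrightarrow> g x"
    by blast
  have bound: "(\<Sum>x\<in>F. (cmod (Rep_ell2 (X m) x - g x))\<^sup>2) \<le> e\<^sup>2"
    if N: "\<And>m n. m \<ge> N \<Longrightarrow> n \<ge> N \<Longrightarrow> dist (X m) (X n) < e" and "m \<ge> N" "finite F" for N m e F
  proof (rule LIMSEQ_le_const2)
    show "(\<lambda>n. \<Sum>x\<in>F. (cmod (Rep_ell2 (X m) x - Rep_ell2 (X n) x))\<^sup>2)
            \<longlonglongrightarrow> (\<Sum>x\<in>F. (cmod (Rep_ell2 (X m) x - g x))\<^sup>2)"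
      by (intro tendsto_sum tendsto_power tendsto_norm tendsto_diff tendsto_const g)
    have "(\<Sum>x\<in>F. (cmod (Rep_ell2 (X m) x - Rep_ell2 (X n) x))\<^sup>2) \<le> e\<^sup>2" if "n \<ge> N" for n
    proof -
      have "(\<Sum>x\<in>F. (cmod (Rep_ell2 (X m) x - Rep_ell2 (X n) x))\<^sup>2) \<le> (norm (X m - X n))\<^sup>2"
        using ell2_finite_sum_le[OF \<open>finite F\<close>, of "X m - X n"] by (simp add: minus_ell2.rep_eq)
      also have "\<dots> \<le> e\<^sup>2"
        using N[OF \<open>m \<ge> N\<close> that] by (intro power_mono) (simp_all add: dist_norm)
      finally show ?thesis .
    qed
    then show "\<exists>M. \<forall>n\<ge>M. (\<Sum>x\<in>F. (cmod (Rep_ell2 (X m) x - Rep_ell2 (X n) x))\<^sup>2) \<le> e\<^sup>2"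
      by blast
  qed
  have summ: "(\<lambda>x. (cmod (Rep_ell2 (X m) x - g x))\<^sup>2) summable_on UNIV"
    if "\<And>m n. m \<ge> N \<Longrightarrow> n \<ge> N \<Longrightarrow> dist (X m) (X n) < e" and "m \<ge> N" for N m e
  proof (rule nonneg_bdd_above_summable_on)
    show "bdd_above (sum (\<lambda>x. (cmod (Rep_ell2 (X m) x - g x))\<^sup>2) ` {F. F \<subseteq> UNIV \<and> finite F})"
      by (rule bdd_aboveI2[where M = "e\<^sup>2"]) (use bound[OF that] in blast)
  qed simp
  obtain N where N: "\<And>m n. m \<ge> N \<Longrightarrow> n \<ge> N \<Longrightarrow> dist (X m) (X n) < 1"
    using metric_CauchyD[OF X zero_less_one] by blast
  have "(\<lambda>x. (cmod (g x - Rep_ell2 (X N) x + Rep_ell2 (X N) x))\<^sup>2) summable_on UNIV"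
    by (rule ell2_add_summable)
      (use summ[OF N order_refl] Rep_ell2[of "X N"] in \<open>simp_all add: norm_minus_commute\<close>)
  then have g_in: "g \<in> {f. (\<lambda>x. (cmod (f x))\<^sup>2) summable_on UNIV}"
    by simp
  have "X \<longlonglongrightarrow> Abs_ell2 g"
  proof (rule metric_LIMSEQ_I)
    fix e :: real
    assume "e > 0"
    then obtain N where N: "\<And>m n. m \<ge> N \<Longrightarrow> n \<ge> N \<Longrightarrow> dist (X m) (X n) < e / 2"
      using metric_CauchyD[OF X half_gt_zero] by blast
    have "dist (X m) (Abs_ell2 g) < e" if "m \<ge> N" for m
    proof -
      have "(norm (X m - Abs_ell2 g))\<^sup>2 \<le> (e / 2)\<^sup>2"
        unfolding norm_ell2_sq minus_ell2.rep_eq Abs_ell2_inverse[OF g_in]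
        by (rule infsum_le_finite_sums) (use summ[OF N that] bound[OF N that] in blast)+
      then have "norm (X m - Abs_ell2 g) \<le> e / 2"
        using \<open>e > 0\<close> by (simp add: power2_le_iff_abs_le)
      then show ?thesis
        using \<open>e > 0\<close> by (simp add: dist_norm)
    qed
    then show "\<exists>N. \<forall>n\<ge>N. dist (X n) (Abs_ell2 g) < e"
      by blast
  qed
  then show "convergent X"
    by (rule convergentI)
qed

instantiation ell2 :: (type) complex_hilbert
begin

lift_definition scaleC_ell2 :: "complex \<Rightarrow> 'a ell2 \<Rightarrow> 'a ell2" is "\<lambda>c f x. c * f x"
  using ell2_scale_summable by auto

lift_definition cinner_ell2 :: "'a ell2 \<Rightarrow> 'a ell2 \<Rightarrow> complex" is
  "\<lambda>f g. \<Sum>\<^sub>\<infinity>x. f x * cnj (g x)" .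

instance
proof
  fix f g h :: "'a ell2" and c d :: complex and r :: real
  show "c *\<^sub>C (f + g) = c *\<^sub>C f + c *\<^sub>C g" by transfer (simp add: algebra_simps)
  show "(c + d) *\<^sub>C f = c *\<^sub>C f + d *\<^sub>C f" by transfer (simp add: algebra_simps)
  show "c *\<^sub>C d *\<^sub>C f = (c * d) *\<^sub>C f" by transfer (simp add: algebra_simps)
  show "complex_of_real r *\<^sub>C f = r *\<^sub>R f" by transfer simp
  show "cinner f g = cnj (cinner g f)"
    by transfer (rule ell2_product_commute)
  show "cinner (f + g) h = cinner f h + cinner g h"
    by transfer (simp add: distrib_right infsum_add ell2_product_summable)
  show "cinner (c *\<^sub>C f) g = c * cinner f g"
    by transfer (simp add: mult.assoc infsum_cmult_right')
  show "inner f g = Re (cinner f g)" by transfer simp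
qed

end

text \<open>In terms of the orthonormal basis \<open>e\<^bsub>i\<^sub>1\<^esub> \<otimes> \<dots> \<otimes> e\<^bsub>i\<^sub>k\<^esub>\<close> of \<open>H\<^sub>n\<^bsup>\<otimes>k\<^esup>\<close>, the full Fock space
  \<open>\<complex>1 \<oplus> \<Oplus>\<^sub>k H\<^sub>n\<^bsup>\<otimes>k\<^esup>\<close> consists of the square-summable coefficient families indexed by all words
  \<open>i\<^sub>1 \<dots> i\<^sub>k\<close>; the vacuum vector \<open>1\<close> corresponds to the empty word. The map
  \<open>\<phi> \<mapsto> e\<^sub>i \<otimes> \<phi>\<close> moves the coefficient of \<open>\<alpha>\<close> to the word \<open>i \<alpha>\<close>.\<close>

type_synonym 'n fock = "'n list ell2"

lemma creation_has_sum:
  fixes f :: "'n list \<Rightarrow> complex"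
  assumes "(\<lambda>\<alpha>. (cmod (f \<alpha>))\<^sup>2) summable_on UNIV"
  shows "((\<lambda>\<alpha>. (cmod (case \<alpha> of [] \<Rightarrow> 0 | j # \<beta> \<Rightarrow> if j = i then f \<beta> else 0))\<^sup>2)
           has_sum (\<Sum>\<^sub>\<infinity>\<alpha>. (cmod (f \<alpha>))\<^sup>2)) UNIV"
proof -
  let ?F = "\<lambda>\<alpha>. (cmod (case \<alpha> of [] \<Rightarrow> 0 | j # \<beta> \<Rightarrow> if j = i then f \<beta> else 0))\<^sup>2"
  have "(?F \<circ> (#) i has_sum (\<Sum>\<^sub>\<infinity>\<alpha>. (cmod (f \<alpha>))\<^sup>2)) UNIV"
    using has_sum_infsum[OF assms] by (simp add: o_def)
  then have "(?F has_sum (\<Sum>\<^sub>\<infinity>\<alpha>. (cmod (f \<alpha>))\<^sup>2)) (range ((#) i))"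
    using has_sum_reindex[of "(#) i" UNIV ?F] by simp
  moreover have "(?F has_sum S) (range ((#) i)) \<longleftrightarrow> (?F has_sum S) UNIV" for S
    by (rule has_sum_cong_neutral) (auto split: list.splits)
  ultimately show ?thesis
    by (simp only:)
qed

lift_definition creation_fun :: "'n \<Rightarrow> 'n fock \<Rightarrow> 'n fock" is
  "\<lambda>i f \<alpha>. case \<alpha> of [] \<Rightarrow> 0 | j # \<beta> \<Rightarrow> if j = i then f \<beta> else 0"
  by (rule has_sum_imp_summable[OF creation_has_sum])

lemma norm_creation_fun: "norm (creation_fun i f) = norm f"
proof -
  have "(norm (creation_fun i f))\<^sup>2 = (norm f)\<^sup>2"
    unfolding norm_ell2_sq creation_fun.rep_eq
    using infsumI[OF creation_has_sum, of "Rep_ell2 f"] Rep_ell2[of f] by simp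
  then show ?thesis
    by (simp add: power2_eq_iff_nonneg)
qed

lift_definition creation :: "'n \<Rightarrow> 'n fock \<Rightarrow>\<^sub>L 'n fock" is creation_fun
proof (rule bounded_linear_intro[where K = 1])
  fix i :: 'n and f g :: "'n fock" and r :: real
  show "creation_fun i (f + g) = creation_fun i f + creation_fun i g"
    by transfer (auto simp: fun_eq_iff split: list.splits)
  show "creation_fun i (r *\<^sub>R f) = r *\<^sub>R creation_fun i f"
    by transfer (auto simp: fun_eq_iff split: list.splits)
qed (simp add: norm_creation_fun)

lemma creation_in_complex_ops: "creation i \<in> complex_ops"
proof -
  have "creation_fun i (c *\<^sub>C f) = c *\<^sub>C creation_fun i f" for c f
    by transfer (auto simp: fun_eq_iff split: list.splits)
  then show ?thesis
    by (simp add: complex_ops_def creation.rep_eq)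
qed

definition closed_unital_subalgebra :: "('h::complex_hilbert \<Rightarrow>\<^sub>L 'h) set \<Rightarrow> bool" where
  "closed_unital_subalgebra A \<longleftrightarrow>
     closed A \<and> id_blinfun \<in> A \<and>
     (\<forall>x\<in>A. \<forall>y\<in>A. x + y \<in> A \<and> x o\<^sub>L y \<in> A) \<and> (\<forall>c. \<forall>x\<in>A. scale_op c x \<in> A)"

definition disc_algebra :: "('n::finite fock \<Rightarrow>\<^sub>L 'n fock) set" where
  "disc_algebra = \<Inter> {A. closed_unital_subalgebra A \<and> range creation \<subseteq> A}"

text \<open>The boundary function is the limit of \<open>f(r S\<^sub>1, \<dots>, r S\<^sub>n)\<close>, \<open>r \<rightarrow> 1\<close>, in operator norm.\<close>

definition boundary_in_disc_algebra :: "('n::finite list \<Rightarrow> complex) \<Rightarrow> bool" where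
  "boundary_in_disc_algebra a \<longleftrightarrow>
     (\<exists>F\<in>disc_algebra. ((\<lambda>r. free_eval a (\<lambda>i. r *\<^sub>R creation i)) \<longlongrightarrow> F) (at_left (1::real)))"

end

theory Submission
  imports Defs "HOL-Complex_Analysis.Riemann_Mapping"
begin

text \<open>Truncating the left creation operators to words of length at most \<open>N\<close> and placing them on an
  orthonormal family of \<open>\<K>\<close>, contractivity of \<open>f\<close> and the Schwarz-Pick lemma along \<open>z \<mapsto> z S\<close> show
  that the row \<open>f(s S)\<close> has norm at most \<open>q = (c + s) / (1 + c s) < 1\<close>, where \<open>c = \<parallel>f(0)\<parallel>\<close>. This is an
  inequality between finite sums in the coefficients, so it also holds for Hilbert-space-valued
  sequences \<open>g\<close> indexed by words. If \<open>r(T) < s < 1\<close>, then \<open>g(\<gamma>) = s\<^bsup>-|\<gamma>|\<^esup> T\<^sub>\<gamma>\<^sup>* h\<close> is square-summable,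
  \<open>h \<mapsto> \<parallel>g\<parallel>\<close> is an equivalent norm and \<open>h \<mapsto> g\<close> intertwines \<open>f(T)\<^sup>*\<close> with \<open>f(s S)\<^sup>*\<close>; iterating the
  inequality over words gives \<open>r(f(T)) \<le> q\<close>. Continuity holds because the condition \<open>r(T) < 1\<close> is
  witnessed by a single power, hence persists with uniform geometric bounds near \<open>T\<close>.\<close>

text \<open>Contractivity concerns tuples on \<open>'k\<close> with row norm below 1, while T acts
  on an arbitrary \<open>'h\<close> with only r(T) < 1: both T and f(T) may have large norm, so no
  estimate in the given norm can suffice. What the two spaces share is the coefficient family, and
  truncation reduces contractivity to statements about it: the truncated creation operators are
  nilpotent, every evaluation is a polynomial, and a finite orthonormal family in \<open>'k\<close>
  is enough. The price is that inserting T yields partial sums of the adjoint of f(T), cut off at a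
  degree depending on the word; limits restore the series. Adjoints appear throughout because the
  spectral radius is governed by square sums of adjoint words applied to a vector, and these split
  under concatenation. Contractivity of the row alone would give r(f(T)) at most 1; the strict gain
  needs both s < 1 and c < 1. Since q is iterated in the new norm, the constant comparing the two
  norms enters once and is removed by the 2k-th root.\<close>

instance complex_hilbert \<subseteq> banach ..

section \<open>Adjoints\<close>

text \<open>The representing vector minimizes \<open>J\<close>; vanishing of the directional
  derivatives there is the identity \<open>\<phi> x = inner x y\<close>. Completeness enters because
  the parallelogram law makes minimizing sequences Cauchy.\<close>

lemma riesz_representation:
  fixes \<phi> :: "'a::{real_inner,complete_space} \<Rightarrow> real"
  assumes "bounded_linear \<phi>"
  shows "\<exists>y. \<forall>x. \<phi> x = inner x y"
proof -
  note add = linear_add[OF bounded_linear.linear[OF assms]]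
    and scaleR = linear_cmul[OF bounded_linear.linear[OF assms]]
  define J where "J x = (norm x)\<^sup>2 / 2 - \<phi> x" for x
  obtain M where "\<forall>x. norm (\<phi> x) \<le> norm x * M"
    using bounded_linear.bounded[OF assms] ..
  then have M: "\<bar>\<phi> x\<bar> \<le> norm x * M" for x
    by simp
  have bdd: "bdd_below (range J)"
  proof (rule bdd_belowI2)
    show "- M\<^sup>2 / 2 \<le> J x" for x
      using abs_le_D1[OF M[of x]] zero_le_power2[of "norm x - M"]
      unfolding J_def power2_diff by (simp add: mult.commute)
  qed
  have parallelogram: "(norm (x - y))\<^sup>2 = 4 * (J x + J y - 2 * J ((1/2) *\<^sub>R (x + y)))" for x y
  proof -
    have "(norm ((1/2) *\<^sub>R (x + y)))\<^sup>2 = ((norm x)\<^sup>2 + 2 * inner x y + (norm y)\<^sup>2) / 4"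
      by (simp only: scaleR_right_distrib[symmetric] norm_scaleR power_mult_distrib dot_norm) (simp add: power2_eq_square field_simps)
    moreover have "(norm (x - y))\<^sup>2 = (norm x)\<^sup>2 - 2 * inner x y + (norm y)\<^sup>2"
      by (simp add: dot_norm_neg field_simps)
    moreover have "\<phi> ((1/2) *\<^sub>R (x + y)) = (\<phi> x + \<phi> y) / 2"
      by (simp add: add scaleR)
    ultimately show ?thesis
      unfolding J_def by (simp only:) argo
  qed
  have "\<exists>x. J x < Inf (range J) + 1 / real (Suc n)" for n
    using cInf_lessD[of "range J" "Inf (range J) + 1 / real (Suc n)"] by auto
  then obtain X where X: "\<And>n. J (X n) < Inf (range J) + 1 / real (Suc n)"
    by metis
  \<comment> \<open>The midpoint of two near-minimizers cannot lie below the infimum, so the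
    parallelogram identity bounds their squared distance by four times the sum of two excesses,
    whence the 8.\<close>
  have close: "(norm (X m - X n))\<^sup>2 \<le> 8 / real (Suc N)" if "m \<ge> N" "n \<ge> N" for m n N
  proof -
    have "1 / real (Suc m) \<le> 1 / real (Suc N)" "1 / real (Suc n) \<le> 1 / real (Suc N)"
      using that by (simp_all add: frac_le)
    moreover have "Inf (range J) \<le> J ((1/2) *\<^sub>R (X m + X n))"
      by (rule cInf_lower[OF _ bdd]) simp
    ultimately have "J (X m) + J (X n) - 2 * J ((1/2) *\<^sub>R (X m + X n)) \<le> 2 * (1 / real (Suc N))"
      using X[of m] X[of n] by linarith
    then show ?thesis
      unfolding parallelogram[of "X m" "X n"] by simp
  qed
  have "Cauchy X"
  proof (rule metric_CauchyI)
    fix e :: real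
    assume "e > 0"
    then obtain N where N: "8 / e\<^sup>2 < real N"
      using reals_Archimedean2 by blast
    have "dist (X m) (X n) < e" if "m \<ge> N" "n \<ge> N" for m n
    proof -
      have "8 < real N * e\<^sup>2"
        using N \<open>e > 0\<close> by (simp add: pos_divide_less_eq)
      also have "\<dots> \<le> real (Suc N) * e\<^sup>2"
        by (intro mult_right_mono) simp_all
      finally have "8 / real (Suc N) < e\<^sup>2"
        by (simp add: pos_divide_less_eq mult.commute)
      then have "(norm (X m - X n))\<^sup>2 < e\<^sup>2"
        using close[OF that] by simp
      then show ?thesis
        using \<open>e > 0\<close> by (simp add: dist_norm power_less_imp_less_base)
    qed
    then show "\<exists>N. \<forall>m\<ge>N. \<forall>n\<ge>N. dist (X m) (X n) < e"
      by blast
  qed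
  then obtain y where y: "X \<longlonglongrightarrow> y"
    using Cauchy_convergent convergent_def by blast
  have "(\<lambda>n. J (X n)) \<longlonglongrightarrow> J y"
    unfolding J_def by (intro tendsto_intros y bounded_linear.tendsto[OF assms]) simp
  moreover have "(\<lambda>n. Inf (range J) + 1 / real (Suc n)) \<longlonglongrightarrow> Inf (range J) + 0"
    by (intro tendsto_add tendsto_const LIMSEQ_Suc[OF lim_1_over_n])
  ultimately have "J y \<le> Inf (range J) + 0"
    by (rule LIMSEQ_le) (use X less_imp_le in blast)
  then have min: "J y \<le> J x" for x
    using cInf_lower[OF _ bdd, of "J x"] by simp
  have "\<phi> x = inner x y" for x
  proof (rule ccontr)
    assume "\<phi> x \<noteq> inner x y"
    define d where "d = inner x y - \<phi> x"
    then have "d \<noteq> 0" and "x \<noteq> 0"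
      using \<open>\<phi> x \<noteq> inner x y\<close> linear_0[OF bounded_linear.linear[OF assms]] by auto
    then have "inner x x > 0"
      by simp
    \<comment> \<open>This is the minimizer of the quadratic
      \<open>t * d + t\<^sup>2 * inner x x / 2\<close>, whose value there is negative because
      \<open>d \<noteq> 0\<close>.\<close>
    define t where "t = - d / inner x x"
    have "J (y + t *\<^sub>R x) = J y + t * d + t\<^sup>2 * inner x x / 2"
    proof -
      have "(norm (y + t *\<^sub>R x))\<^sup>2 = (norm y)\<^sup>2 + 2 * t * inner x y + t\<^sup>2 * inner x x"
        unfolding power2_norm_eq_inner
        by (simp add: inner_add_left inner_add_right power2_eq_square inner_commute[of y x] algebra_simps)
      then show ?thesis
        unfolding J_def d_def by (simp add: add scaleR algebra_simps)
    qed
    moreover have "t * d + t\<^sup>2 * inner x x / 2 = - (d\<^sup>2 / (2 * inner x x))"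
      using \<open>inner x x > 0\<close> by (simp add: t_def power2_eq_square field_simps)
    moreover have "d\<^sup>2 / (2 * inner x x) > 0"
      using \<open>inner x x > 0\<close> \<open>d \<noteq> 0\<close> by simp
    ultimately show False
      using min[of "y + t *\<^sub>R x"] by linarith
  qed
  then show ?thesis
    by blast
qed

section \<open>Algebra of the complex inner product and scalar multiplication\<close>

lemma cinner_add_right: "cinner x (y + z) = cinner x y + cinner x z"
  by (metis cinner_add_left cinner_commute complex_cnj_add)

lemma cinner_scaleC_right: "cinner x (c *\<^sub>C y) = cnj c * cinner x y"
  by (metis cinner_scaleC_left cinner_commute complex_cnj_mult)

lemma cinner_zero_left [simp]: "cinner 0 x = 0"
  using cinner_add_left[of 0 0 x] by simp

lemma cinner_zero_right [simp]: "cinner x 0 = 0"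
  using cinner_add_right[of x 0 0] by simp

lemma cinner_diff_left: "cinner (x - y) z = cinner x z - cinner y z"
  using cinner_add_left[of "x - y" y z] by simp

lemma cinner_diff_right: "cinner x (y - z) = cinner x y - cinner x z"
  using cinner_add_right[of x "y - z" z] by simp

lemma cinner_sum_left: "cinner (\<Sum>i\<in>I. f i) x = (\<Sum>i\<in>I. cinner (f i) x)"
  by (induction I rule: infinite_finite_induct) (simp_all add: cinner_add_left)

lemma cinner_sum_right: "cinner x (\<Sum>i\<in>I. f i) = (\<Sum>i\<in>I. cinner x (f i))"
  by (induction I rule: infinite_finite_induct) (simp_all add: cinner_add_right)

lemma scaleC_zero_right [simp]: "c *\<^sub>C (0::'a::complex_hilbert) = 0"
  by (rule linear_simps[OF bounded_linear_scaleC])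

lemma scaleC_zero_left [simp]: "0 *\<^sub>C (x::'a::complex_hilbert) = 0"
  using scaleC_of_real[of 0 x] by simp

lemma scaleC_one [simp]: "1 *\<^sub>C (x::'a::complex_hilbert) = x"
  using scaleC_of_real[of 1 x] by simp

lemma scaleC_sum_right: "c *\<^sub>C (\<Sum>i\<in>I. f i) = (\<Sum>i\<in>I. c *\<^sub>C f i)" for f :: "'i \<Rightarrow> 'a::complex_hilbert"
  by (induction I rule: infinite_finite_induct) (simp_all add: scaleC_add_right)

lemma scaleC_sum_left: "(\<Sum>i\<in>I. f i) *\<^sub>C (x::'a::complex_hilbert) = (\<Sum>i\<in>I. f i *\<^sub>C x)"
  by (induction I rule: infinite_finite_induct) (simp_all add: scaleC_add_left)

lemma cmod_cinner_le: "cmod (cinner x y) \<le> norm x * norm y"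
proof (cases "cinner x y = 0")
  case False
  \<comment> \<open>A unimodular factor rotates \<open>cinner x y\<close> onto the positive real
    axis, where the real Cauchy-Schwarz inequality applies.\<close>
  define c where "c = cnj (cinner x y) / cmod (cinner x y)"
  have "cmod c = 1"
    using False by (simp add: c_def norm_divide)
  have "cinner (c *\<^sub>C x) y = complex_of_real (cmod (cinner x y))"
    using False unfolding c_def cinner_scaleC_left
    by (simp add: divide_simps mult.commute[of "cnj _"] complex_norm_square[symmetric] power2_eq_square)
  then have "cmod (cinner x y) = inner (c *\<^sub>C x) y"
    by (simp add: inner_eq_Re_cinner)
  also have "\<dots> \<le> norm (c *\<^sub>C x) * norm y"
    by (rule norm_cauchy_schwarz)
  finally show ?thesis
    using \<open>cmod c = 1\<close> by (simp add: norm_scaleC)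
qed simp

lemma cinner_right_eqI: "(\<And>x. cinner x y = cinner x z) \<Longrightarrow> y = z"
  by (metis inner_eq_Re_cinner vector_eq_ldot)

lemma ex_adjoint:
  fixes A :: "'h::complex_hilbert \<Rightarrow>\<^sub>L 'h"
  assumes "A \<in> complex_ops"
  shows "\<exists>B. \<forall>x y. cinner (A x) y = cinner x (blinfun_apply B y)"
proof -
  have "\<exists>z. \<forall>x. inner (A x) y = inner x z" for y
    by (rule riesz_representation) (intro bounded_linear_intros)
  then obtain B where B: "\<And>x y. inner (A x) y = inner x (B y)"
    by metis
  have A: "A (c *\<^sub>C x) = c *\<^sub>C A x" for c x
    using assms by (simp add: complex_ops_def)
  have cB: "cinner (A x) y = cinner x (B y)" for x y
  proof -
    \<comment> \<open>Riesz gives the identity for real parts only. The imaginary part is a real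
      part after multiplying the first argument by \<open>-\<i>\<close>, and complex linearity moves
      that factor through \<open>A\<close>.\<close>
    have "Im (cinner u v) = Re (cinner ((-\<i>) *\<^sub>C u) v)" for u v :: 'h
      by (simp add: cinner_scaleC_left)
    then show ?thesis
      using B by (simp add: complex_eq_iff inner_eq_Re_cinner A[symmetric])
  qed
  have "bounded_linear B"
  proof (rule bounded_linear_intro)
    show "B (x + y) = B x + B y" for x y
      by (rule cinner_right_eqI) (simp add: cB[symmetric] cinner_add_right)
    show "B (r *\<^sub>R x) = r *\<^sub>R B x" for r x
      by (rule cinner_right_eqI)
        (simp add: cB[symmetric] cinner_scaleC_right flip: scaleC_of_real)
    show "norm (B x) \<le> norm x * norm A" for x
    proof (cases "B x = 0")
      case False
      have "norm (B x) * norm (B x) = inner (A (B x)) x"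
        by (simp add: B power2_norm_eq_inner[symmetric] power2_eq_square[symmetric])
      also have "\<dots> \<le> norm (A (B x)) * norm x"
        by (rule norm_cauchy_schwarz)
      also have "\<dots> \<le> norm A * norm (B x) * norm x"
        by (intro mult_right_mono norm_blinfun) simp
      finally show ?thesis
        using False by (simp add: mult.commute)
    qed simp
  qed
  then show ?thesis
    using cB by (metis bounded_linear_Blinfun_apply)
qed

text \<open>Complex linearity gives existence and nondegeneracy gives uniqueness, so the definite
  description in \<open>adjoint_op\<close> denotes. Conversely the identity for all \<open>x\<close>
  and \<open>y\<close> forces \<open>A\<close> to be complex linear, so \<open>complex_ops\<close>
  is the natural domain of the adjoint calculus.\<close>

lemma cinner_adjoint_op:
  assumes "A \<in> complex_ops"
  shows "cinner (A x) y = cinner x (adjoint_op A y)"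
proof -
  have "\<exists>!B. \<forall>x y. cinner (A x) y = cinner x (blinfun_apply B y)"
    by (rule ex_ex1I[OF ex_adjoint[OF assms]])
      (metis blinfun_eqI cinner_right_eqI)
  from theI'[OF this] show ?thesis
    unfolding adjoint_op_def by blast
qed

lemma adjoint_op_eqI:
  assumes "\<And>x y. cinner (blinfun_apply A x) y = cinner x (blinfun_apply B y)"
  shows "adjoint_op A = B"
  unfolding adjoint_op_def
proof (rule the_equality)
  show "C = B" if "\<forall>x y. cinner (A x) y = cinner x (blinfun_apply C y)" for C
    by (intro blinfun_eqI cinner_right_eqI) (use assms that in simp)
qed (simp add: assms)

lemma cinner_adjoint_op_left:
  assumes "A \<in> complex_ops"
  shows "cinner (adjoint_op A x) y = cinner x (A y)"
  by (metis assms cinner_adjoint_op cinner_commute)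

section \<open>Closure properties of the complex-linear operators and rules for adjoints\<close>

lemma scale_op_apply [simp]: "scale_op c A x = c *\<^sub>C A x"
  by (simp add: scale_op.rep_eq)

lemma complex_opsD: "A \<in> complex_ops \<Longrightarrow> A (c *\<^sub>C x) = c *\<^sub>C A x"
  by (simp add: complex_ops_def)

lemma complex_ops_id [simp]: "id_blinfun \<in> complex_ops"
  by (simp add: complex_ops_def)

lemma complex_ops_compose [intro]: "A \<in> complex_ops \<Longrightarrow> B \<in> complex_ops \<Longrightarrow> A o\<^sub>L B \<in> complex_ops"
  by (simp add: complex_ops_def)

lemma complex_ops_diff [intro]: "A \<in> complex_ops \<Longrightarrow> B \<in> complex_ops \<Longrightarrow> A - B \<in> complex_ops"
  by (simp add: complex_ops_def blinfun.diff_left linear_simps(2)[OF bounded_linear_scaleC])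

lemma complex_ops_sum [intro]: "(\<And>i. i \<in> I \<Longrightarrow> A i \<in> complex_ops) \<Longrightarrow> (\<Sum>i\<in>I. A i) \<in> complex_ops"
  by (auto simp: complex_ops_def blinfun.sum_left scaleC_sum_right)

lemma complex_ops_scale_op [intro]: "A \<in> complex_ops \<Longrightarrow> scale_op c A \<in> complex_ops"
  by (auto simp: complex_ops_def scaleC_scaleC mult.commute)

lemma complex_ops_adjoint_op [intro]:
  assumes "A \<in> complex_ops"
  shows "adjoint_op A \<in> complex_ops"
  unfolding complex_ops_def mem_Collect_eq
proof (intro allI)
  show "adjoint_op A (c *\<^sub>C x) = c *\<^sub>C adjoint_op A x" for c x
    by (rule cinner_right_eqI) (simp add: cinner_adjoint_op[OF assms, symmetric] cinner_scaleC_right)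
qed

lemma complex_ops_word_op [intro]: "X \<in> op_tuples \<Longrightarrow> word_op X \<alpha> \<in> complex_ops"
  by (induction \<alpha>) (auto simp: op_tuples_def)

lemma closed_complex_ops: "closed (complex_ops :: ('h::complex_hilbert \<Rightarrow>\<^sub>L 'h) set)"
proof -
  have "complex_ops = (\<Inter>c. \<Inter>x. {A :: 'h \<Rightarrow>\<^sub>L 'h. A (c *\<^sub>C x) = c *\<^sub>C A x})"
    by (auto simp: complex_ops_def)
  also have "closed \<dots>"
    by (intro closed_INT ballI closed_Collect_eq continuous_intros
        bounded_linear.continuous_on[OF bounded_linear_scaleC])
  finally show ?thesis .
qed

lemma adjoint_op_id [simp]: "adjoint_op id_blinfun = id_blinfun"
  by (rule adjoint_op_eqI) simp

lemma adjoint_op_compose: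
  "A \<in> complex_ops \<Longrightarrow> B \<in> complex_ops \<Longrightarrow> adjoint_op (A o\<^sub>L B) = adjoint_op B o\<^sub>L adjoint_op A"
  by (rule adjoint_op_eqI) (simp add: cinner_adjoint_op)

lemma adjoint_op_diff:
  "A \<in> complex_ops \<Longrightarrow> B \<in> complex_ops \<Longrightarrow> adjoint_op (A - B) = adjoint_op A - adjoint_op B"
  by (rule adjoint_op_eqI)
    (simp add: blinfun.diff_left cinner_diff_left cinner_diff_right cinner_adjoint_op)

lemma adjoint_op_sum:
  "(\<And>i. i \<in> I \<Longrightarrow> A i \<in> complex_ops) \<Longrightarrow> adjoint_op (\<Sum>i\<in>I. A i) = (\<Sum>i\<in>I. adjoint_op (A i))"
  by (rule adjoint_op_eqI)
    (simp add: blinfun.sum_left cinner_sum_left cinner_sum_right cinner_adjoint_op)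

lemma adjoint_op_scale_op:
  "A \<in> complex_ops \<Longrightarrow> adjoint_op (scale_op c A) = scale_op (cnj c) (adjoint_op A)"
  by (rule adjoint_op_eqI) (simp add: cinner_scaleC_left cinner_scaleC_right cinner_adjoint_op)

lemma adjoint_op_adjoint_op: "A \<in> complex_ops \<Longrightarrow> adjoint_op (adjoint_op A) = A"
  by (rule adjoint_op_eqI) (simp add: cinner_adjoint_op_left)

lemma norm_adjoint_op_le:
  assumes "A \<in> complex_ops"
  shows "norm (adjoint_op A) \<le> norm A"
proof (rule norm_blinfun_bound)
  fix x
  show "norm (adjoint_op A x) \<le> norm A * norm x"
  proof (cases "adjoint_op A x = 0")
    case False
    have "norm (adjoint_op A x) * norm (adjoint_op A x) = inner (adjoint_op A x) (adjoint_op A x)"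
      by (simp add: power2_norm_eq_inner[symmetric] power2_eq_square[symmetric])
    also have "\<dots> = inner (A (adjoint_op A x)) x"
      by (simp add: assms inner_eq_Re_cinner cinner_adjoint_op)
    also have "\<dots> \<le> norm (A (adjoint_op A x)) * norm x"
      by (rule norm_cauchy_schwarz)
    also have "\<dots> \<le> norm A * norm (adjoint_op A x) * norm x"
      by (intro mult_right_mono norm_blinfun) simp
    finally show ?thesis
      using False by (simp add: mult.commute)
  qed simp
qed simp

lemma norm_adjoint_op: "A \<in> complex_ops \<Longrightarrow> norm (adjoint_op A) = norm A"
  by (metis adjoint_op_adjoint_op antisym complex_ops_adjoint_op norm_adjoint_op_le)

text \<open>The norm of \<open>\<Sum> X\<^sub>i X\<^sub>i\<^sup>*\<close> is the squared norm of the column operator with entries \<open>X\<^sub>i\<^sup>*\<close>.\<close>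

lemma column_le_row_norm:
  assumes "\<And>i. i \<in> I \<Longrightarrow> X i \<in> complex_ops"
  shows "(\<Sum>i\<in>I. (norm (adjoint_op (X i) h))\<^sup>2) \<le> norm (\<Sum>i\<in>I. X i o\<^sub>L adjoint_op (X i)) * (norm h)\<^sup>2"
proof -
  have "(\<Sum>i\<in>I. (norm (adjoint_op (X i) h))\<^sup>2) = inner ((\<Sum>i\<in>I. X i o\<^sub>L adjoint_op (X i)) h) h"
    by (simp add: blinfun.sum_left inner_sum_left power2_norm_eq_inner)
      (simp add: inner_eq_Re_cinner assms cinner_adjoint_op)
  also have "\<dots> \<le> norm ((\<Sum>i\<in>I. X i o\<^sub>L adjoint_op (X i)) h) * norm h"
    by (rule norm_cauchy_schwarz)
  also have "\<dots> \<le> norm (\<Sum>i\<in>I. X i o\<^sub>L adjoint_op (X i)) * norm h * norm h"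
    by (intro mult_right_mono norm_blinfun) simp
  finally show ?thesis
    by (simp add: power2_eq_square mult.assoc)
qed

text \<open>Expanding the squared norm of \<open>S h\<close> pairs the column at \<open>h\<close>
  with the column at \<open>S h\<close>; Cauchy-Schwarz bounds this by
  \<open>C * norm h * norm (S h)\<close>, and one factor \<open>norm (S h)\<close> cancels. No
  square root of a positive operator is involved.\<close>

lemma row_norm_le:
  assumes "\<And>i. i \<in> I \<Longrightarrow> X i \<in> complex_ops"
    and "C \<ge> 0" and C: "\<And>h. (\<Sum>i\<in>I. (norm (adjoint_op (X i) h))\<^sup>2) \<le> C * (norm h)\<^sup>2"
  shows "norm (\<Sum>i\<in>I. X i o\<^sub>L adjoint_op (X i)) \<le> C"
proof (rule norm_blinfun_bound[OF \<open>C \<ge> 0\<close>])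
  fix h
  define S where "S = (\<Sum>i\<in>I. X i o\<^sub>L adjoint_op (X i))"
  show "norm ((\<Sum>i\<in>I. X i o\<^sub>L adjoint_op (X i)) h) \<le> C * norm h"
    unfolding S_def[symmetric]
  proof (cases "S h = 0")
    case False
    have "(norm (S h))\<^sup>2 = (\<Sum>i\<in>I. inner (adjoint_op (X i) h) (adjoint_op (X i) (S h)))"
    proof -
      have "(norm (S h))\<^sup>2 = (\<Sum>i\<in>I. inner (X i (adjoint_op (X i) h)) (S h))"
        by (simp add: power2_norm_eq_inner) (simp add: S_def blinfun.sum_left inner_sum_left)
      then show ?thesis
        using assms(1) by (simp add: inner_eq_Re_cinner cinner_adjoint_op)
    qed
    also have "\<dots> \<le> (\<Sum>i\<in>I. \<bar>norm (adjoint_op (X i) h)\<bar> * \<bar>norm (adjoint_op (X i) (S h))\<bar>)"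
      by (intro sum_mono) (simp add: norm_cauchy_schwarz)
    also have "\<dots> \<le> L2_set (\<lambda>i. norm (adjoint_op (X i) h)) I * L2_set (\<lambda>i. norm (adjoint_op (X i) (S h))) I"
      by (rule L2_set_mult_ineq)
    also have "\<dots> \<le> sqrt (C * (norm h)\<^sup>2) * sqrt (C * (norm (S h))\<^sup>2)"
      unfolding L2_set_def by (intro mult_mono real_sqrt_le_mono C) (simp_all add: \<open>C \<ge> 0\<close> sum_nonneg)
    also have "\<dots> = C * norm h * norm (S h)"
      by (simp add: real_sqrt_mult \<open>C \<ge> 0\<close>)
    finally show "norm (S h) \<le> C * norm h"
      using False by (simp add: power2_eq_square)
  qed (simp add: \<open>C \<ge> 0\<close>)
qed

section \<open>Finite orthonormal families\<close>

definition orthonormal_on :: "'i set \<Rightarrow> ('i \<Rightarrow> 'a::complex_hilbert) \<Rightarrow> bool" where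
  "orthonormal_on W e \<longleftrightarrow> (\<forall>x\<in>W. \<forall>y\<in>W. cinner (e x) (e y) = (if x = y then 1 else 0))"

lemma orthonormal_onD:
  "orthonormal_on W e \<Longrightarrow> x \<in> W \<Longrightarrow> y \<in> W \<Longrightarrow> cinner (e x) (e y) = (if x = y then 1 else 0)"
  by (simp add: orthonormal_on_def)

lemma cinner_orthonormal_combination:
  assumes "finite W" "orthonormal_on W e" "y \<in> W"
  shows "cinner (\<Sum>x\<in>W. c x *\<^sub>C e x) (e y) = c y"
proof -
  have "cinner (\<Sum>x\<in>W. c x *\<^sub>C e x) (e y) = (\<Sum>x\<in>W. if x = y then c x else 0)"
    unfolding cinner_sum_left
    by (intro sum.cong refl) (use assms in \<open>simp add: cinner_scaleC_left orthonormal_onD\<close>)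
  then show ?thesis
    using assms by simp
qed

lemma norm_orthonormal_combination:
  assumes "finite W" "orthonormal_on W e"
  shows "(norm (\<Sum>x\<in>W. c x *\<^sub>C e x))\<^sup>2 = (\<Sum>x\<in>W. (cmod (c x))\<^sup>2)"
proof -
  have "complex_of_real ((norm (\<Sum>x\<in>W. c x *\<^sub>C e x))\<^sup>2) = (\<Sum>y\<in>W. cnj (c y) * c y)"
    unfolding cinner_self[symmetric] cinner_sum_right[where x = "\<Sum>x\<in>W. c x *\<^sub>C e x"]
    using assms by (simp add: cinner_scaleC_right cinner_orthonormal_combination)
  also have "\<dots> = complex_of_real (\<Sum>y\<in>W. (cmod (c y))\<^sup>2)"
    unfolding of_real_sum by (intro sum.cong refl) (simp only: complex_norm_square mult.commute)
  finally show ?thesis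
    unfolding of_real_eq_iff .
qed

lemma cinner_orthogonal_residual:
  assumes "finite W" "orthonormal_on W e" "y \<in> W"
  shows "cinner (h - (\<Sum>x\<in>W. cinner h (e x) *\<^sub>C e x)) (e y) = 0"
  by (simp add: cinner_diff_left cinner_orthonormal_combination[OF assms])

lemma bessel_inequality:
  assumes "finite W" "orthonormal_on W e"
  shows "(\<Sum>x\<in>W. (cmod (cinner h (e x)))\<^sup>2) \<le> (norm h)\<^sup>2"
proof -
  define p where "p = (\<Sum>x\<in>W. cinner h (e x) *\<^sub>C e x)"
  have "cinner (h - p) p = 0"
    unfolding p_def cinner_sum_right[of "h - (\<Sum>x\<in>W. cinner h (e x) *\<^sub>C e x)"]
    using assms by (simp add: cinner_scaleC_right cinner_orthogonal_residual)
  then have "inner (h - p) p = 0"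
    by (simp add: inner_eq_Re_cinner)
  then have "(norm h)\<^sup>2 = (norm (h - p))\<^sup>2 + (norm p)\<^sup>2"
    using norm_add_Pythagorean[of "h - p" p] by (simp add: orthogonal_def)
  then show ?thesis
    using assms by (simp add: p_def norm_orthonormal_combination)
qed

lemma parseval_identity:
  assumes "finite W" "orthonormal_on W e" "h = (\<Sum>x\<in>W. cinner h (e x) *\<^sub>C e x)"
  shows "(norm h)\<^sup>2 = (\<Sum>x\<in>W. (cmod (cinner h (e x)))\<^sup>2)"
  using norm_orthonormal_combination[OF assms(1,2), of "\<lambda>x. cinner h (e x)"]
  by (simp only: assms(3)[symmetric])

lemma sgn_eq_scaleC: "sgn w = complex_of_real (inverse (norm w)) *\<^sub>C (w::'a::complex_hilbert)"
  by (simp add: sgn_div_norm scaleC_of_real del: of_real_inverse)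

lemma orthonormal_on_insert:
  assumes "orthonormal_on W e" "x \<notin> W" "w \<noteq> 0" "\<And>y. y \<in> W \<Longrightarrow> cinner w (e y) = 0"
  shows "orthonormal_on (insert x W) (e(x := sgn w))"
proof -
  have left: "cinner (sgn w) (e y) = 0" if "y \<in> W" for y
    using assms(4)[OF that] by (simp add: sgn_eq_scaleC cinner_scaleC_left)
  have right: "cinner (e y) (sgn w) = 0" if "y \<in> W" for y
    using left[OF that] by (subst cinner_commute) simp
  have "cinner (sgn w) (sgn w) = 1"
    using assms(3) by (simp add: cinner_self norm_sgn)
  then show ?thesis
    using assms(1,2) left right by (auto simp: orthonormal_on_def)
qed

text \<open>Gram-Schmidt, adding one vector at a time. The new unit vector is orthogonal to the old
  basis, so the expansions of the earlier vectors only gain a zero coefficient.\<close>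

lemma ex_orthonormal_basis:
  fixes V :: "'a::complex_hilbert set"
  assumes "finite V"
  shows "\<exists>B. finite B \<and> orthonormal_on B (\<lambda>b. b) \<and> (\<forall>v\<in>V. v = (\<Sum>b\<in>B. cinner v b *\<^sub>C b))"
  using assms
proof (induction V rule: finite_induct)
  case empty
  show ?case
    by (rule exI[of _ "{}"]) (simp add: orthonormal_on_def)
next
  case (insert v V)
  then obtain B where B: "finite B" "orthonormal_on B (\<lambda>b. b)"
    and V: "\<And>v. v \<in> V \<Longrightarrow> v = (\<Sum>b\<in>B. cinner v b *\<^sub>C b)"
    by blast
  define w where "w = v - (\<Sum>b\<in>B. cinner v b *\<^sub>C b)"
  show ?case
  proof (cases "w = 0")
    case True
    then show ?thesis
      using B V by (intro exI[of _ B]) (auto simp: w_def)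
  next
    case False
    define u where "u = sgn w"
    have wB: "cinner w b = 0" if "b \<in> B" for b
      using cinner_orthogonal_residual[OF B that] by (simp add: w_def)
    have uu: "cinner u u = 1"
      using False by (simp add: u_def cinner_self norm_sgn)
    have uB: "cinner u b = 0" if "b \<in> B" for b
      using wB[OF that] by (simp add: u_def sgn_eq_scaleC cinner_scaleC_left)
    have Bu: "cinner b u = 0" if "b \<in> B" for b
      using uB[OF that] by (subst cinner_commute) simp
    have "u \<notin> B"
      using uu uB by fastforce
    have on: "orthonormal_on (insert u B) (\<lambda>b. b)"
      using B(2) uu uB Bu \<open>u \<notin> B\<close> by (auto simp: orthonormal_on_def)
    have wu: "w = complex_of_real (norm w) *\<^sub>C u"
      using False by (simp add: u_def sgn_eq_scaleC scaleC_scaleC)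
    have sum_u: "cinner (\<Sum>b\<in>B. c b *\<^sub>C b) u = 0" for c
      using Bu by (simp add: cinner_sum_left cinner_scaleC_left)
    have "cinner v u *\<^sub>C u = w"
    proof -
      have "cinner v u = cinner w u"
        using sum_u by (simp add: w_def cinner_diff_left)
      also have "\<dots> = complex_of_real (norm w)"
        by (subst wu) (simp add: cinner_scaleC_left uu)
      finally show ?thesis
        using wu by simp
    qed
    then have "v = (\<Sum>b\<in>insert u B. cinner v b *\<^sub>C b)"
      using B(1) \<open>u \<notin> B\<close> by (simp add: w_def)
    moreover have "v' = (\<Sum>b\<in>insert u B. cinner v' b *\<^sub>C b)" if "v' \<in> V" for v'
    proof -
      have "cinner v' u = 0"
        by (subst V[OF that]) (rule sum_u)
      then show ?thesis
        using B(1) \<open>u \<notin> B\<close> V[OF that] by simp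
    qed
    ultimately show ?thesis
      using B(1) on by (intro exI[of _ "insert u B"]) blast
  qed
qed

text \<open>Infinite dimension always leaves a vector outside the span of the finitely many vectors
  already chosen; its normalized residual extends the family.\<close>

lemma ex_orthonormal_family:
  fixes W :: "'i set"
  assumes "separable_infinite_dimensional TYPE('k::complex_hilbert)" "finite W"
  shows "\<exists>e :: 'i \<Rightarrow> 'k. orthonormal_on W e"
  using assms(2)
proof (induction W rule: finite_induct)
  case (insert x W)
  then obtain e :: "'i \<Rightarrow> 'k" where e: "orthonormal_on W e"
    by blast
  \<comment> \<open>Infinite dimensionality is phrased with coefficients attached to vectors rather
    than indices; injectivity translates between the two kinds of sum.\<close>
  have "inj_on e W"
    using e by (intro inj_onI) (metis orthonormal_onD zero_neq_one)
  obtain y where y: "\<And>c. y \<noteq> (\<Sum>b\<in>e ` W. c b *\<^sub>C b)"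
    using assms(1) insert.hyps(1) unfolding separable_infinite_dimensional_def by blast
  define w where "w = y - (\<Sum>x\<in>W. cinner y (e x) *\<^sub>C e x)"
  have "w \<noteq> 0"
    using y[of "cinner y"] \<open>inj_on e W\<close> by (simp add: w_def sum.reindex)
  then show ?case
    using orthonormal_on_insert[OF e insert.hyps(2)] cinner_orthogonal_residual[OF insert.hyps(1) e]
    unfolding w_def by blast
qed (simp add: orthonormal_on_def)

section \<open>Submultiplicative sequences\<close>

text \<open>Division with remainder splits \<open>k\<close> into blocks of length \<open>m\<close>,
  each contributing at most \<open>t ^ m\<close>, and fewer than \<open>m\<close> single steps, each
  contributing at most \<open>R\<close>. Since \<open>R / t \<ge> 1\<close>, the exponent of the
  excess factor may be raised from \<open>k mod m\<close> to \<open>m\<close>, which makes the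
  constant independent of \<open>k\<close> and of all other values of \<open>c\<close>.\<close>

lemma submultiplicative_geometric_bound:
  fixes c :: "nat \<Rightarrow> real"
  assumes nonneg: "\<And>k. c k \<ge> 0" and mult: "\<And>k l. c (k + l) \<le> c k * c l"
    and "c 0 \<le> 1" "c 1 \<le> R" "c m \<le> t ^ m" "0 < t" "t \<le> R" "m \<ge> 1"
  shows "c k \<le> (R / t) ^ m * t ^ k"
proof -
  have pow: "c (l * j) \<le> c l ^ j" for l j
  proof (induction j)
    case (Suc j)
    have "c (l * Suc j) \<le> c l * c (l * j)"
      using mult[of l "l * j"] by simp
    also have "\<dots> \<le> c l * c l ^ j"
      by (intro mult_left_mono Suc nonneg)
    finally show ?case
      by simp
  qed (use \<open>c 0 \<le> 1\<close> in simp)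
  have "c k \<le> c (m * (k div m)) * c (1 * (k mod m))"
    using mult[of "m * (k div m)" "k mod m"] by simp
  also have "\<dots> \<le> (t ^ m) ^ (k div m) * R ^ (k mod m)"
  proof (intro mult_mono)
    show "c (m * (k div m)) \<le> (t ^ m) ^ (k div m)"
      by (rule order_trans[OF pow]) (intro power_mono assms)
    show "c (1 * (k mod m)) \<le> R ^ (k mod m)"
      by (rule order_trans[OF pow]) (intro power_mono assms)
  qed (use assms in auto)
  also have "\<dots> = t ^ (m * (k div m)) * t ^ (k mod m) * (R / t) ^ (k mod m)"
    using \<open>t > 0\<close> by (simp add: power_mult power_divide)
  also have "\<dots> = t ^ k * (R / t) ^ (k mod m)"
    by (simp flip: power_add)
  also have "\<dots> \<le> t ^ k * (R / t) ^ m"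
    using assms by (intro mult_left_mono power_increasing) auto
  finally show ?thesis
    by (simp add: mult.commute)
qed

lemma root_const_mult_power:
  assumes "D > 0" "t \<ge> 0"
  shows "(\<lambda>k. root k (D * t ^ k)) \<longlonglongrightarrow> t"
proof (rule Lim_transform_eventually)
  show "(\<lambda>k. root k D * t) \<longlonglongrightarrow> t"
    using tendsto_mult_right[OF LIMSEQ_root_const[OF assms(1)], of t] by simp
  show "\<forall>\<^sub>F k in sequentially. root k D * t = root k (D * t ^ k)"
    using eventually_gt_at_top[of 0]
    by eventually_elim (simp add: real_root_mult real_root_power_cancel assms)
qed

text \<open>Fekete's lemma, in a form without logarithms because \<open>c k\<close> may vanish. The
  limit is the infimum over \<open>k \<ge> 1\<close>: one index \<open>m\<close> with root below
  \<open>t\<close> bounds all large indices through the geometric bound. Convergence gives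
  \<open>lim\<close> in \<open>joint_spectral_radius\<close> its meaning.\<close>

lemma submultiplicative_root_convergent:
  fixes c :: "nat \<Rightarrow> real"
  assumes nonneg: "\<And>k. c k \<ge> 0" and mult: "\<And>k l. c (k + l) \<le> c k * c l" and "c 0 \<le> 1"
  shows "convergent (\<lambda>k. root k (c k))"
proof -
  define L where "L = Inf ((\<lambda>k. root k (c k)) ` {1..})"
  have bdd: "bdd_below ((\<lambda>k. root k (c k)) ` {1..})"
    by (rule bdd_belowI2[where m = 0]) (simp add: nonneg)
  have lower: "L \<le> root k (c k)" if "k \<ge> 1" for k
    unfolding L_def by (rule cInf_lower[OF _ bdd]) (use that in auto)
  have "L \<ge> 0"
    unfolding L_def by (rule cInf_greatest) (auto simp: nonneg)
  have "(\<lambda>k. root k (c k)) \<longlonglongrightarrow> L"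
  proof (rule order_tendstoI)
    fix x
    assume "x < L"
    show "\<forall>\<^sub>F k in sequentially. x < root k (c k)"
      using eventually_ge_at_top[of 1]
      by eventually_elim (use \<open>x < L\<close> lower in \<open>blast intro: less_le_trans\<close>)
  next
    fix x
    assume "L < x"
    then obtain t where t: "L < t" "t < x"
      using dense by blast
    then obtain m where m: "m \<ge> 1" "root m (c m) < t"
      using cInf_lessD[of "(\<lambda>k. root k (c k)) ` {1..}" t] unfolding L_def by auto
    have "root m (c m) ^ m \<le> t ^ m"
      using m by (intro power_mono) (auto simp: nonneg)
    then have "c m \<le> t ^ m"
      using m nonneg by simp
    define R where "R = max t (c 1)"
    have "t > 0"
      using \<open>L \<ge> 0\<close> t by simp
    have bound: "c k \<le> (R / t) ^ m * t ^ k" for k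
      by (rule submultiplicative_geometric_bound)
        (use assms \<open>c m \<le> t ^ m\<close> \<open>t > 0\<close> m in \<open>auto simp: R_def\<close>)
    have "R > 0"
      using \<open>t > 0\<close> by (simp add: R_def)
    then have "(\<lambda>k. root k ((R / t) ^ m * t ^ k)) \<longlonglongrightarrow> t"
      using \<open>t > 0\<close> by (intro root_const_mult_power) auto
    from order_tendstoD(2)[OF this \<open>t < x\<close>] eventually_gt_at_top[of 0]
    show "\<forall>\<^sub>F k in sequentially. root k (c k) < x"
      by eventually_elim (use bound in \<open>meson le_less_trans real_root_le_mono\<close>)
  qed
  then show ?thesis
    by (rule convergentI)
qed

section \<open>The joint spectral radius\<close>

lemma finite_words [simp]: "finite {\<alpha> :: 'n::finite list. length \<alpha> = k}"
  using finite_lists_length_eq[of "UNIV :: 'n set" k] by simp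

lemma finite_words_le [simp]: "finite {\<alpha> :: 'n::finite list. length \<alpha> \<le> k}"
  using finite_lists_length_le[of "UNIV :: 'n set" k] by simp

lemma finite_words_less [simp]: "finite {\<alpha> :: 'n::finite list. length \<alpha> < k}"
  by (rule finite_subset[OF _ finite_words_le[of k]]) auto

lemma sum_words_add:
  "(\<Sum>\<gamma> :: 'n::finite list | length \<gamma> = k + l. F \<gamma>) = (\<Sum>\<alpha> | length \<alpha> = k. \<Sum>\<beta> | length \<beta> = l. F (\<alpha> @ \<beta>))"
  unfolding sum.cartesian_product
  by (rule sum.reindex_bij_witness[where i = "\<lambda>(\<alpha>, \<beta>). \<alpha> @ \<beta>" and j = "\<lambda>\<gamma>. (take k \<gamma>, drop k \<gamma>)"])
    auto

lemma sum_words_Suc: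
  "(\<Sum>\<gamma> :: 'n::finite list | length \<gamma> = Suc k. F \<gamma>) = (\<Sum>i\<in>UNIV. \<Sum>\<beta> | length \<beta> = k. F (i # \<beta>))"
  unfolding sum.cartesian_product
  by (rule sum.reindex_bij_witness[where i = "\<lambda>(i, \<beta>). i # \<beta>" and j = "\<lambda>\<gamma>. (hd \<gamma>, tl \<gamma>)"])
    (auto simp: length_Suc_conv)

lemma sum_words_le:
  "(\<Sum>\<gamma> :: 'n::finite list | length \<gamma> \<le> N. F \<gamma>) = (\<Sum>k\<le>N. \<Sum>\<gamma> | length \<gamma> = k. F \<gamma>)"
  by (subst sum.group[where g = length and T = "{..N}", symmetric])
    (auto intro!: sum.cong)

lemma word_op_append: "word_op X (\<alpha> @ \<beta>) = word_op X \<alpha> o\<^sub>L word_op X \<beta>"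
  by (induction \<alpha>) (auto intro: blinfun_eqI)

definition power_norm :: "('n::finite \<Rightarrow> 'h::complex_hilbert \<Rightarrow>\<^sub>L 'h) \<Rightarrow> nat \<Rightarrow> real" where
  "power_norm X k = norm (\<Sum>\<alpha> | length \<alpha> = k. word_op X \<alpha> o\<^sub>L adjoint_op (word_op X \<alpha>))"

text \<open>For \<open>X \<in> op_tuples\<close> this is the quadratic form at \<open>h\<close> of
  the operator whose norm is \<open>power_norm X k\<close>. Unlike that norm, it splits exactly when
  words are concatenated.\<close>

definition energy :: "('n::finite \<Rightarrow> 'h::complex_hilbert \<Rightarrow>\<^sub>L 'h) \<Rightarrow> nat \<Rightarrow> 'h \<Rightarrow> real" where
  "energy X k h = (\<Sum>\<alpha> | length \<alpha> = k. (norm (adjoint_op (word_op X \<alpha>) h))\<^sup>2)"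

lemma power_norm_nonneg [simp]: "power_norm X k \<ge> 0"
  by (simp add: power_norm_def)

lemma energy_nonneg [simp]: "energy X k h \<ge> 0"
  by (simp add: energy_def sum_nonneg)

lemma energy_le: "X \<in> op_tuples \<Longrightarrow> energy X k h \<le> power_norm X k * (norm h)\<^sup>2"
  unfolding energy_def power_norm_def by (rule column_le_row_norm) blast

lemma power_norm_le:
  assumes "X \<in> op_tuples" "C \<ge> 0" "\<And>h. energy X k h \<le> C * (norm h)\<^sup>2"
  shows "power_norm X k \<le> C"
  unfolding power_norm_def
  by (rule row_norm_le) (use assms in \<open>auto simp: energy_def\<close>)

lemma adjoint_op_word_op_append:
  "X \<in> op_tuples \<Longrightarrow>
    adjoint_op (word_op X (\<alpha> @ \<beta>)) = adjoint_op (word_op X \<beta>) o\<^sub>L adjoint_op (word_op X \<alpha>)"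
  by (simp add: word_op_append adjoint_op_compose complex_ops_word_op)

lemma energy_add:
  "X \<in> op_tuples \<Longrightarrow>
    energy X (k + l) h = (\<Sum>\<alpha> | length \<alpha> = k. energy X l (adjoint_op (word_op X \<alpha>) h))"
  by (simp add: energy_def sum_words_add adjoint_op_word_op_append)

lemma power_norm_add:
  assumes "X \<in> op_tuples"
  shows "power_norm X (k + l) \<le> power_norm X k * power_norm X l"
proof (rule power_norm_le[OF assms])
  fix h
  have "energy X (k + l) h \<le> (\<Sum>\<alpha> | length \<alpha> = k. power_norm X l * (norm (adjoint_op (word_op X \<alpha>) h))\<^sup>2)"
    unfolding energy_add[OF assms] by (intro sum_mono energy_le assms)
  also have "\<dots> = power_norm X l * energy X k h"
    by (simp add: energy_def sum_distrib_left)
  also have "\<dots> \<le> power_norm X l * (power_norm X k * (norm h)\<^sup>2)"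
    by (intro mult_left_mono energy_le assms) simp
  finally show "energy X (k + l) h \<le> power_norm X k * power_norm X l * (norm h)\<^sup>2"
    by (simp add: mult_ac)
qed simp

lemma power_norm_0: "X \<in> op_tuples \<Longrightarrow> power_norm X 0 \<le> 1"
  by (rule power_norm_le) (auto simp: energy_def)

lemma joint_spectral_radius_LIMSEQ:
  assumes "X \<in> op_tuples"
  shows "(\<lambda>k. root (2 * k) (power_norm X k)) \<longlonglongrightarrow> joint_spectral_radius X"
proof -
  have "convergent (\<lambda>k. root k (power_norm X k))"
    by (rule submultiplicative_root_convergent) (simp_all add: assms power_norm_add power_norm_0)
  then obtain L where "(\<lambda>k. root k (power_norm X k)) \<longlonglongrightarrow> L"
    unfolding convergent_def ..
  from tendsto_real_sqrt[OF this] have "convergent (\<lambda>k. root (2 * k) (power_norm X k))"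
    unfolding real_root_mult_exp sqrt_def[symmetric] by (rule convergentI)
  then show ?thesis
    unfolding joint_spectral_radius_def power_norm_def[symmetric] convergent_LIMSEQ_iff .
qed

text \<open>A limit below 1 yields a single index with \<open>power_norm X m < 1\<close>; a number
  \<open>y\<close> strictly between them gives \<open>t\<close> as its \<open>m\<close>-th root. The
  strict inequality at one \<open>m\<close> is a condition that survives small perturbations of
  \<open>X\<close>.\<close>

lemma spectral_ball_power_norm:
  assumes "X \<in> spectral_ball"
  obtains m t where "m \<ge> 1" "0 < t" "t < 1" "power_norm X m < t ^ m"
proof -
  have X: "X \<in> op_tuples" "joint_spectral_radius X < 1"
    using assms by (auto simp: spectral_ball_def)
  have "\<forall>\<^sub>F k in sequentially. k \<ge> 1 \<and> root (2 * k) (power_norm X k) < 1"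
    using order_tendstoD(2)[OF joint_spectral_radius_LIMSEQ[OF X(1)] X(2)]
    by (intro eventually_conj eventually_ge_at_top)
  then obtain m where m: "m \<ge> 1" "root (2 * m) (power_norm X m) < 1"
    using eventually_happens' sequentially_bot by blast
  then have "power_norm X m < 1"
    by simp
  then obtain y where y: "power_norm X m < y" "y < 1"
    using dense by blast
  moreover have "y > 0"
    using y power_norm_nonneg[of X m] by linarith
  ultimately show ?thesis
    using m(1) by (intro that[of m "root m y"]) auto
qed

lemma joint_spectral_radius_le:
  assumes "X \<in> op_tuples" "D > 0" "q \<ge> 0" "\<And>k. power_norm X k \<le> D * (q\<^sup>2) ^ k"
  shows "joint_spectral_radius X \<le> q"
proof (rule LIMSEQ_le[OF joint_spectral_radius_LIMSEQ[OF assms(1)]])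
  have "(\<lambda>k. sqrt (root k (D * (q\<^sup>2) ^ k))) \<longlonglongrightarrow> sqrt (q\<^sup>2)"
    by (intro tendsto_real_sqrt root_const_mult_power) (use assms in auto)
  then show "(\<lambda>k. root (2 * k) (D * (q\<^sup>2) ^ k)) \<longlonglongrightarrow> q"
    using assms(3) unfolding real_root_mult_exp sqrt_def[symmetric] by simp
  show "\<exists>N. \<forall>k\<ge>N. root (2 * k) (power_norm X k) \<le> root (2 * k) (D * (q\<^sup>2) ^ k)"
    by (rule exI[of _ 1]) (simp add: assms(4))
qed

section \<open>The Schwarz-Pick bound\<close>

lemma cmod_Moebius_identity:
  "(cmod (1 - cnj w * u))\<^sup>2 - (cmod (u - w))\<^sup>2 = (1 - (cmod u)\<^sup>2) * (1 - (cmod w)\<^sup>2)"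
  unfolding cmod_power2 by (simp add: algebra_simps power2_eq_square)

text \<open>For prescribed moduli the pseudohyperbolic distance is smallest when \<open>u\<close>
  and \<open>w\<close> have the same argument. Replacing the denominator by its lower bound
  \<open>1 - a * b\<close> therefore reduces the claim to real numbers.\<close>

lemma cmod_le_of_pseudo_distance:
  assumes "cmod u < 1" "cmod w < 1" "0 \<le> s" "s < 1"
    and le: "cmod (u - w) \<le> s * cmod (1 - cnj w * u)"
  shows "cmod u * (1 + s * cmod w) \<le> cmod w + s"
proof -
  define a b where "a = cmod u" and "b = cmod w"
  have ab: "0 \<le> a" "0 \<le> b" "a < 1" "b < 1"
    using assms by (auto simp: a_def b_def)
  have "a * b \<le> 1"
    using ab by (simp add: mult_le_one)
  have "(1 - a * b)\<^sup>2 \<le> (cmod (1 - cnj w * u))\<^sup>2"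
  proof (rule power_mono)
    show "1 - a * b \<le> cmod (1 - cnj w * u)"
      using norm_triangle_ineq2[of 1 "cnj w * u"] by (simp add: norm_mult a_def b_def mult.commute)
  qed (use \<open>a * b \<le> 1\<close> in simp)
  moreover have "s\<^sup>2 \<le> 1"
    using assms by (simp add: power_le_one)
  ultimately have "(1 - s\<^sup>2) * (1 - a * b)\<^sup>2 \<le> (1 - s\<^sup>2) * (cmod (1 - cnj w * u))\<^sup>2"
    by (intro mult_left_mono) auto
  also have "\<dots> \<le> (cmod (1 - cnj w * u))\<^sup>2 - (cmod (u - w))\<^sup>2"
    using power_mono[OF le, of 2] by (simp add: power_mult_distrib left_diff_distrib)
  also have "\<dots> = (1 - a\<^sup>2) * (1 - b\<^sup>2)"
    by (simp add: cmod_Moebius_identity a_def b_def)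
  also have "\<dots> = (1 - a * b)\<^sup>2 - (a - b)\<^sup>2"
    by (simp add: power2_eq_square algebra_simps)
  finally have "(a - b)\<^sup>2 \<le> (s * (1 - a * b))\<^sup>2"
    by (simp add: power_mult_distrib left_diff_distrib)
  then have "a - b \<le> s * (1 - a * b)"
    by (rule power2_le_imp_le) (use \<open>a * b \<le> 1\<close> assms(3) in auto)
  then show ?thesis
    by (simp add: a_def[symmetric] b_def[symmetric] algebra_simps)
qed

text \<open>The addition formula of tanh: for \<open>c\<close> and \<open>s\<close> in [0, 1) it is
  the largest modulus in the closed pseudohyperbolic disc of radius \<open>s\<close> about a point
  of modulus \<open>c\<close>.\<close>

definition pick_bound :: "real \<Rightarrow> real \<Rightarrow> real" where
  "pick_bound c s = (c + s) / (1 + c * s)"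

lemma pick_bound_mono:
  assumes "0 \<le> b" "b \<le> c" "0 \<le> s" "s < 1"
  shows "pick_bound b s \<le> pick_bound c s"
proof -
  have "0 \<le> (c - b) * (1 - s * s)"
    using assms by (intro mult_nonneg_nonneg) (auto intro: mult_le_one)
  then have "(b + s) * (1 + c * s) \<le> (c + s) * (1 + b * s)"
    by (simp add: algebra_simps)
  moreover have "1 + b * s > 0" "1 + c * s > 0"
    using assms by (auto intro: add_pos_nonneg)
  ultimately show ?thesis
    by (simp add: pick_bound_def divide_simps mult.commute)
qed

lemma pick_bound_nonneg: "0 \<le> c \<Longrightarrow> 0 \<le> s \<Longrightarrow> 0 \<le> pick_bound c s"
  by (simp add: pick_bound_def)

lemma pick_bound_less_1:
  assumes "0 \<le> c" "c < 1" "0 \<le> s" "s < 1"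
  shows "pick_bound c s < 1"
proof -
  have "0 < (1 - c) * (1 - s)"
    using assms by simp
  then have "c + s < 1 + c * s"
    by (simp add: algebra_simps)
  then show ?thesis
    using assms by (simp add: pick_bound_def)
qed

lemma schwarz_pick_strict:
  assumes hol: "\<phi> holomorphic_on ball 0 1"
    and lt: "\<And>z. cmod z < 1 \<Longrightarrow> cmod (\<phi> z) < 1" and "0 \<le> s" "s < 1"
  shows "cmod (\<phi> (complex_of_real s)) \<le> pick_bound (cmod (\<phi> 0)) s"
proof -
  define w where "w = \<phi> 0"
  have w: "cmod w < 1"
    by (simp add: w_def lt)
  have "(Moebius_function 0 w \<circ> \<phi>) holomorphic_on ball 0 1"
    by (rule holomorphic_on_compose_gen[OF hol Moebius_function_holomorphic[OF w]])
      (use lt in auto)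
  from Schwarz_Lemma(1)[OF this, of "complex_of_real s"]
  have "cmod (Moebius_function 0 w (\<phi> (complex_of_real s))) \<le> s"
    using assms w by (simp add: Moebius_function_eq_zero Moebius_function_norm_lt_1 flip: w_def)
  moreover have "1 - cnj w * \<phi> (complex_of_real s) \<noteq> 0"
  proof
    assume "1 - cnj w * \<phi> (complex_of_real s) = 0"
    then have "cmod (cnj w * \<phi> (complex_of_real s)) = 1"
      by (metis norm_one right_minus_eq)
    moreover have "cmod (cnj w * \<phi> (complex_of_real s)) < 1"
      using norm_mult_less[of "cnj w" 1 "\<phi> (complex_of_real s)" 1] w lt assms by simp
    ultimately show False
      by simp
  qed
  ultimately have "cmod (\<phi> (complex_of_real s) - w) \<le> s * cmod (1 - cnj w * \<phi> (complex_of_real s))"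
    by (simp add: Moebius_function_simple norm_divide pos_divide_le_eq)
  then have "cmod (\<phi> (complex_of_real s)) * (1 + s * cmod w) \<le> cmod w + s"
    using w lt assms by (intro cmod_le_of_pseudo_distance) auto
  moreover have "1 + s * cmod w > 0"
    using assms by (simp add: add_pos_nonneg)
  ultimately show ?thesis
    by (simp add: pick_bound_def pos_le_divide_eq mult.commute flip: w_def)
qed

text \<open>Values of modulus 1 are allowed here, where the Moebius argument breaks down.
  Multiplying by \<open>\<rho> < 1\<close> moves all values into the open disc, and monotonicity of
  \<open>pick_bound\<close> makes the bound independent of \<open>\<rho>\<close>.\<close>

lemma schwarz_pick:
  assumes hol: "\<phi> holomorphic_on ball 0 1"
    and le: "\<And>z. cmod z < 1 \<Longrightarrow> cmod (\<phi> z) \<le> 1"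
    and "cmod (\<phi> 0) \<le> c" "0 \<le> s" "s < 1"
  shows "cmod (\<phi> (complex_of_real s)) \<le> pick_bound c s"
proof (rule field_le_mult_one_interval)
  fix \<rho> :: real
  assume \<rho>: "0 < \<rho>" "\<rho> < 1"
  have "cmod (complex_of_real \<rho> * \<phi> (complex_of_real s))
      \<le> pick_bound (cmod (complex_of_real \<rho> * \<phi> 0)) s"
  proof (rule schwarz_pick_strict)
    show "cmod (complex_of_real \<rho> * \<phi> z) < 1" if "cmod z < 1" for z
    proof -
      have "\<rho> * cmod (\<phi> z) \<le> \<rho> * 1"
        using le[OF that] \<rho> by (intro mult_left_mono) auto
      also have "\<dots> < 1"
        using \<rho> by simp
      finally show ?thesis
        using \<rho> by (simp add: norm_mult)
    qed
  qed (use assms in \<open>auto intro!: holomorphic_intros\<close>)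
  also have "\<dots> \<le> pick_bound c s"
  proof (rule pick_bound_mono)
    show "cmod (complex_of_real \<rho> * \<phi> 0) \<le> c"
      using mult_right_mono[of \<rho> 1 "cmod (\<phi> 0)"] \<rho> assms(3) by (simp add: norm_mult)
  qed (use assms in auto)
  finally show "\<rho> * cmod (\<phi> (complex_of_real s)) \<le> pick_bound c s"
    using \<rho> by (simp add: norm_mult)
qed

section \<open>Truncated creation operators\<close>

lemma bounded_linear_rank_one: "bounded_linear (\<lambda>h::'k::complex_hilbert. cinner h b *\<^sub>C v)"
proof (rule bounded_linear_intro[where K = "norm b * norm v"])
  show "cinner (r *\<^sub>R h) b *\<^sub>C v = r *\<^sub>R cinner h b *\<^sub>C v" for r and h :: 'k
    by (simp add: cinner_scaleC_left scaleC_scaleC flip: scaleC_of_real)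
  show "norm (cinner h b *\<^sub>C v) \<le> norm h * (norm b * norm v)" for h
    using mult_right_mono[OF cmod_cinner_le[of h b], of "norm v"] by (simp add: norm_scaleC mult.assoc)
qed (simp add: cinner_add_left scaleC_add_left)

text \<open>For \<open>e\<close> orthonormal on the words of length at most \<open>N\<close>, this is the compression of the
  creation operator to the corresponding finite-dimensional piece of the Fock space.\<close>

definition truncated_creation ::
  "nat \<Rightarrow> ('n::finite list \<Rightarrow> 'k::complex_hilbert) \<Rightarrow> 'n \<Rightarrow> ('k \<Rightarrow>\<^sub>L 'k)" where
  "truncated_creation N e i = Blinfun (\<lambda>h. \<Sum>\<beta> | length \<beta> < N. cinner h (e \<beta>) *\<^sub>C e (i # \<beta>))"

lemma truncated_creation_apply:
  "truncated_creation N e i h = (\<Sum>\<beta> | length \<beta> < N. cinner h (e \<beta>) *\<^sub>C e (i # \<beta>))"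
  unfolding truncated_creation_def
  by (subst bounded_linear_Blinfun_apply) (auto intro!: bounded_linear_sum bounded_linear_rank_one)

lemma truncated_creation_complex: "truncated_creation N e i \<in> complex_ops"
  by (simp add: complex_ops_def truncated_creation_apply cinner_scaleC_left scaleC_sum_right scaleC_scaleC)

lemma adjoint_truncated_creation_apply:
  "adjoint_op (truncated_creation N e i) h = (\<Sum>\<beta> | length \<beta> < N. cinner h (e (i # \<beta>)) *\<^sub>C e \<beta>)"
proof -
  have bl: "bounded_linear (\<lambda>h. \<Sum>\<beta> | length \<beta> < N. cinner h (e (i # \<beta>)) *\<^sub>C e \<beta>)"
    by (auto intro!: bounded_linear_sum bounded_linear_rank_one)
  have "adjoint_op (truncated_creation N e i) =
      Blinfun (\<lambda>h. \<Sum>\<beta> | length \<beta> < N. cinner h (e (i # \<beta>)) *\<^sub>C e \<beta>)"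
  proof (rule adjoint_op_eqI)
    fix x y
    have "cinner (e (i # \<beta>)) y = cnj (cinner y (e (i # \<beta>)))" for \<beta>
      by (rule cinner_commute)
    then show "cinner (truncated_creation N e i x) y =
        cinner x (Blinfun (\<lambda>h. \<Sum>\<beta> | length \<beta> < N. cinner h (e (i # \<beta>)) *\<^sub>C e \<beta>) y)"
      by (simp add: bounded_linear_Blinfun_apply[OF bl] truncated_creation_apply cinner_sum_left
          cinner_sum_right cinner_scaleC_left cinner_scaleC_right mult.commute)
  qed
  then show ?thesis
    by (simp add: bounded_linear_Blinfun_apply[OF bl])
qed

text \<open>The word is kept nonempty because the empty word acts as the identity on the whole
  space, whereas the formula would give the projection onto the span of the family.\<close>

lemma word_truncated_creation_apply:
  assumes e: "orthonormal_on {\<beta>. length \<beta> \<le> N} e"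
  shows "word_op (truncated_creation N e) (i # \<alpha>) h =
    (\<Sum>\<beta> | length (i # \<alpha>) + length \<beta> \<le> N. cinner h (e \<beta>) *\<^sub>C e (i # \<alpha> @ \<beta>))"
proof (induction \<alpha> arbitrary: i)
  case Nil
  show ?case
    by (simp add: truncated_creation_apply Suc_le_eq)
next
  case (Cons j \<alpha>)
  have basis: "truncated_creation N e i (e \<gamma>) = (if length \<gamma> < N then e (i # \<gamma>) else 0)"
    if "length \<gamma> \<le> N" for \<gamma>
  proof -
    have "truncated_creation N e i (e \<gamma>) = (\<Sum>\<beta> | length \<beta> < N. if \<gamma> = \<beta> then e (i # \<beta>) else 0)"
      unfolding truncated_creation_apply
      by (intro sum.cong refl) (use that in \<open>simp add: orthonormal_onD[OF e]\<close>)
    then show ?thesis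
      by simp
  qed
  have lin: "truncated_creation N e i (c *\<^sub>C x) = c *\<^sub>C truncated_creation N e i x" for c x
    by (rule complex_opsD[OF truncated_creation_complex])
  have "word_op (truncated_creation N e) (i # j # \<alpha>) h =
    truncated_creation N e i (word_op (truncated_creation N e) (j # \<alpha>) h)"
    by simp
  also have "\<dots> = (\<Sum>\<beta> | length (j # \<alpha>) + length \<beta> \<le> N.
      cinner h (e \<beta>) *\<^sub>C truncated_creation N e i (e (j # \<alpha> @ \<beta>)))"
    by (simp only: Cons.IH blinfun.sum_right lin)
  also have "\<dots> = (\<Sum>\<beta> | length (j # \<alpha>) + length \<beta> \<le> N.
      if length (i # j # \<alpha>) + length \<beta> \<le> N then cinner h (e \<beta>) *\<^sub>C e (i # (j # \<alpha>) @ \<beta>) else 0)"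
    by (intro sum.cong refl) (auto simp: basis)
  also have "\<dots> = (\<Sum>\<beta> | length (i # j # \<alpha>) + length \<beta> \<le> N. cinner h (e \<beta>) *\<^sub>C e (i # (j # \<alpha>) @ \<beta>))"
    by (intro sum.mono_neutral_cong_right) (auto intro: finite_subset[OF _ finite_words_le[of N]])
  finally show ?case .
qed

lemma word_truncated_creation_nilpotent:
  assumes "orthonormal_on {\<beta>. length \<beta> \<le> N} e" "length \<alpha> > N"
  shows "word_op (truncated_creation N e) \<alpha> = 0"
proof (rule blinfun_eqI)
  fix h
  obtain i \<beta> where "\<alpha> = i # \<beta>"
    using assms(2) by (cases \<alpha>) auto
  then show "word_op (truncated_creation N e) \<alpha> h = blinfun_apply 0 h"
    using assms by (simp add: word_truncated_creation_apply del: word_op.simps)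
qed

lemma word_truncated_creation_basis:
  assumes e: "orthonormal_on {\<beta>. length \<beta> \<le> N} e" and "length \<beta> \<le> N"
  shows "word_op (truncated_creation N e) \<alpha> (e \<beta>) = (if length \<alpha> + length \<beta> \<le> N then e (\<alpha> @ \<beta>) else 0)"
proof (cases \<alpha>)
  case Nil
  then show ?thesis
    using assms by simp
next
  case (Cons i \<alpha>')
  have "word_op (truncated_creation N e) (i # \<alpha>') (e \<beta>) =
    (\<Sum>\<gamma> | length (i # \<alpha>') + length \<gamma> \<le> N. if \<beta> = \<gamma> then e (i # \<alpha>' @ \<gamma>) else 0)"
    unfolding word_truncated_creation_apply[OF e]
    by (intro sum.cong refl) (use \<open>length \<beta> \<le> N\<close> in \<open>simp add: orthonormal_onD[OF e]\<close>)
  also have "\<dots> = (if length (i # \<alpha>') + length \<beta> \<le> N then e (i # \<alpha>' @ \<beta>) else 0)"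
    by (subst sum.delta') (auto intro: finite_subset[OF _ finite_words_le[of N]])
  finally show ?thesis
    by (simp add: Cons)
qed

text \<open>Each nonempty word of length at most \<open>N\<close> arises from exactly one pair of
  first letter and tail, so the column norm is part of a single Bessel sum.\<close>

lemma truncated_creation_column:
  assumes e: "orthonormal_on {\<beta>. length \<beta> \<le> N} e"
  shows "(\<Sum>i\<in>UNIV. (norm (adjoint_op (truncated_creation N e i) h))\<^sup>2) \<le> (norm h)\<^sup>2"
proof -
  have e': "orthonormal_on {\<beta>. length \<beta> < N} e"
    using e by (simp add: orthonormal_on_def)
  have "(\<Sum>i\<in>UNIV. (norm (adjoint_op (truncated_creation N e i) h))\<^sup>2) =
    (\<Sum>i\<in>UNIV. \<Sum>\<beta> | length \<beta> < N. (cmod (cinner h (e (i # \<beta>))))\<^sup>2)"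
    unfolding adjoint_truncated_creation_apply
    by (intro sum.cong refl norm_orthonormal_combination e') simp
  also have "\<dots> = (\<Sum>\<gamma>\<in>(\<lambda>(i, \<beta>). i # \<beta>) ` (UNIV \<times> {\<beta>. length \<beta> < N}). (cmod (cinner h (e \<gamma>)))\<^sup>2)"
    unfolding sum.cartesian_product
    by (subst sum.reindex) (auto simp: inj_on_def intro!: sum.cong)
  also have "\<dots> \<le> (\<Sum>\<gamma> | length \<gamma> \<le> N. (cmod (cinner h (e \<gamma>)))\<^sup>2)"
    by (rule sum_mono2) auto
  also have "\<dots> \<le> (norm h)\<^sup>2"
    by (rule bessel_inequality[OF _ e]) simp
  finally show ?thesis .
qed

section \<open>Scaled truncated creation operators and evaluation of the series at them\<close>

lemma scale_op_scale_op: "scale_op c (scale_op d A) = scale_op (c * d) A"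
  by (rule blinfun_eqI) (simp add: scaleC_scaleC)

lemma word_op_scale_op:
  assumes "X \<in> op_tuples"
  shows "word_op (\<lambda>i. scale_op z (X i)) \<alpha> = scale_op (z ^ length \<alpha>) (word_op X \<alpha>)"
proof (induction \<alpha>)
  case (Cons i \<alpha>)
  have "X i \<in> complex_ops"
    using assms by (simp add: op_tuples_def)
  then show ?case
    by (intro blinfun_eqI) (simp add: Cons complex_opsD scaleC_scaleC)
qed (auto intro: blinfun_eqI)

lemma truncated_creation_op_ball:
  fixes e :: "'n::finite list \<Rightarrow> 'k::complex_hilbert"
  assumes "orthonormal_on {\<beta>. length \<beta> \<le> N} e" "cmod z < 1"
  shows "(\<lambda>i. scale_op z (truncated_creation N e i)) \<in> op_ball"
proof -
  have c: "scale_op z (truncated_creation N e i) \<in> complex_ops" for i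
    by (intro complex_ops_scale_op truncated_creation_complex)
  have "norm (\<Sum>i\<in>UNIV. scale_op z (truncated_creation N e i) o\<^sub>L
      adjoint_op (scale_op z (truncated_creation N e i))) \<le> (cmod z)\<^sup>2"
  proof (rule row_norm_le)
    fix h
    have "(\<Sum>i\<in>UNIV. (norm (adjoint_op (scale_op z (truncated_creation N e i)) h))\<^sup>2) =
      (cmod z)\<^sup>2 * (\<Sum>i\<in>UNIV. (norm (adjoint_op (truncated_creation N e i) h))\<^sup>2)"
      by (simp add: adjoint_op_scale_op truncated_creation_complex norm_scaleC power_mult_distrib
          sum_distrib_left)
    also have "\<dots> \<le> (cmod z)\<^sup>2 * (norm h)\<^sup>2"
      by (intro mult_left_mono truncated_creation_column assms) simp
    finally show "(\<Sum>i\<in>UNIV. (norm (adjoint_op (scale_op z (truncated_creation N e i)) h))\<^sup>2)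
      \<le> (cmod z)\<^sup>2 * (norm h)\<^sup>2" .
  qed (simp_all add: c)
  also have "(cmod z)\<^sup>2 < 1"
    using assms(2) by (simp add: abs_square_less_1)
  finally show ?thesis
    using c by (simp add: op_ball_def op_tuples_def)
qed

lemma free_eval_truncated_creation:
  assumes "orthonormal_on {\<beta>. length \<beta> \<le> N} e"
  shows "free_eval a (\<lambda>i. scale_op z (truncated_creation N e i)) =
    (\<Sum>\<alpha> | length \<alpha> \<le> N. scale_op (a \<alpha> * z ^ length \<alpha>) (word_op (truncated_creation N e) \<alpha>))"
proof -
  have S: "truncated_creation N e \<in> op_tuples"
    by (simp add: op_tuples_def truncated_creation_complex)
  have "scale_op c 0 = 0" for c
    by (rule blinfun_eqI) simp
  then show ?thesis
    unfolding free_eval_def sum_words_le word_op_scale_op[OF S] scale_op_scale_op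
    by (intro suminf_finite) (auto intro!: sum.neutral simp: word_truncated_creation_nilpotent[OF assms])
qed

section \<open>Contractivity on the truncated Fock space\<close>

lemma bounded_linear_row_operator: "bounded_linear (row_operator F)"
  unfolding row_operator_def
  by (intro bounded_linear_sum blinfun.bounded_linear_right
      bounded_linear_compose[OF blinfun.bounded_linear_right bounded_linear_vec_nth])

lemma norm_vec_sq: "(norm (x :: 'a::real_normed_vector ^ 'm))\<^sup>2 = (\<Sum>j\<in>UNIV. (norm (x $ j))\<^sup>2)"
  by (simp add: norm_vec_def L2_set_def sum_nonneg)

lemma cauchy_schwarz_sum_scaleC:
  fixes x :: "complex ^ 'm" and u :: "'k::complex_hilbert ^ 'm"
  shows "norm (\<Sum>j\<in>UNIV. (x $ j) *\<^sub>C (u $ j)) \<le> norm x * norm u"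
proof -
  have "norm (\<Sum>j\<in>UNIV. (x $ j) *\<^sub>C (u $ j)) \<le> (\<Sum>j\<in>UNIV. \<bar>norm (x $ j)\<bar> * \<bar>norm (u $ j)\<bar>)"
    by (rule order_trans[OF norm_sum]) (simp add: norm_scaleC)
  also have "\<dots> \<le> norm x * norm u"
    unfolding norm_vec_def by (rule L2_set_mult_ineq)
  finally show ?thesis .
qed

text \<open>Schwarz-Pick applies to \<open>z \<mapsto> \<langle>f(z S) u, v\<rangle>\<close>, which is a polynomial because the truncated
  creation operators are nilpotent.\<close>

lemma truncated_row_bound:
  fixes a :: "'m::finite \<Rightarrow> 'n::finite list \<Rightarrow> complex" and e :: "'n list \<Rightarrow> 'k::complex_hilbert"
  assumes e: "orthonormal_on {\<beta>. length \<beta> \<le> N} e" and contr: "contractive TYPE('k) a"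
    and "0 \<le> s" "s < 1"
  shows "cmod (cinner (row_operator (free_map a (\<lambda>i. scale_op (complex_of_real s) (truncated_creation N e i))) u) v)
    \<le> pick_bound (norm (value_at_zero a)) s * (norm u * norm v)"
proof (cases "u = 0 \<or> v = 0")
  case True
  then show ?thesis
    by (auto simp: row_operator_def)
next
  case False
  define X where "X z = (\<lambda>i. scale_op z (truncated_creation N e i))" for z
  define \<phi> where "\<phi> z = cinner (row_operator (free_map a (X z)) u) v" for z
  \<comment> \<open>Dividing by \<open>C\<close> brings the values of \<open>\<phi>\<close> into the
    closed unit disc; the zero vectors were split off so that this division is possible.\<close>
  define C where "C = norm u * norm v"
  have "C > 0"
    using False by (simp add: C_def)
  have "\<phi> z = (\<Sum>j\<in>UNIV. \<Sum>\<alpha> | length \<alpha> \<le> N.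
      a j \<alpha> * z ^ length \<alpha> * cinner (word_op (truncated_creation N e) \<alpha> (u $ j)) v)" for z
    by (simp add: \<phi>_def X_def free_map_def row_operator_def free_eval_truncated_creation[OF e]
        blinfun.sum_left cinner_sum_left cinner_scaleC_left)
  then have "\<phi> = (\<lambda>z. \<Sum>j\<in>UNIV. \<Sum>\<alpha> | length \<alpha> \<le> N.
      a j \<alpha> * z ^ length \<alpha> * cinner (word_op (truncated_creation N e) \<alpha> (u $ j)) v)"
    by blast
  then have hol: "\<phi> holomorphic_on ball 0 1"
    by (auto intro!: holomorphic_intros)
  have le: "cmod (\<phi> z) \<le> C" if "cmod z < 1" for z
  proof -
    have "onorm (row_operator (free_map a (X z))) \<le> 1"
      using contr truncated_creation_op_ball[OF e that] unfolding contractive_def X_def by blast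
    then have "norm (row_operator (free_map a (X z)) u) \<le> norm u"
      using onorm[OF bounded_linear_row_operator, of "free_map a (X z)" u]
        mult_right_mono[of "onorm (row_operator (free_map a (X z)))" 1 "norm u"] by simp
    then show ?thesis
      unfolding \<phi>_def C_def
      by (intro order_trans[OF cmod_cinner_le] mult_right_mono) auto
  qed
  have "X 0 = (\<lambda>i. 0)"
    by (auto simp: X_def intro!: ext blinfun_eqI)
  then have "row_operator (free_map a (X 0)) u = (\<Sum>j\<in>UNIV. (value_at_zero a $ j) *\<^sub>C (u $ j))"
    by (simp add: row_operator_def free_map_zero)
  then have "cmod (\<phi> 0) \<le> norm (\<Sum>j\<in>UNIV. (value_at_zero a $ j) *\<^sub>C (u $ j)) * norm v"
    unfolding \<phi>_def by (simp add: cmod_cinner_le)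
  also have "\<dots> \<le> norm (value_at_zero a) * norm u * norm v"
    by (intro mult_right_mono cauchy_schwarz_sum_scaleC) simp
  finally have zero: "cmod (\<phi> 0) \<le> norm (value_at_zero a) * C"
    by (simp add: C_def mult.assoc)
  have "cmod (\<phi> (complex_of_real s) / complex_of_real C) \<le> pick_bound (norm (value_at_zero a)) s"
    by (rule schwarz_pick[where \<phi> = "\<lambda>z. \<phi> z / complex_of_real C"])
      (use hol le zero \<open>C > 0\<close> assms in \<open>auto intro!: holomorphic_intros simp: norm_divide pos_divide_le_eq\<close>)
  then have "cmod (\<phi> (complex_of_real s)) \<le> pick_bound (norm (value_at_zero a)) s * C"
    using \<open>C > 0\<close> by (simp add: norm_divide pos_divide_le_eq)
  then show ?thesis
    by (simp add: \<phi>_def X_def C_def)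
qed

text \<open>The row bound is dualized: \<open>w\<close> holds the coordinates of a vector
  \<open>v\<close>, and the inner sums are the coordinates of the adjoint row applied to
  \<open>v\<close>. The resulting inequality mentions only coefficients and numbers, with no
  operator on \<open>'k\<close> left.\<close>

lemma truncated_kernel_scalar:
  fixes a :: "'m::finite \<Rightarrow> 'n::finite list \<Rightarrow> complex" and w :: "'n list \<Rightarrow> complex"
  assumes "separable_infinite_dimensional TYPE('k::complex_hilbert)" "contractive TYPE('k) a"
    and "0 \<le> s" "s < 1"
  shows "(\<Sum>j\<in>UNIV. \<Sum>\<beta> | length \<beta> \<le> N.
      (cmod (\<Sum>\<alpha> | length \<alpha> + length \<beta> \<le> N. cnj (a j \<alpha>) * complex_of_real s ^ length \<alpha> * w (\<alpha> @ \<beta>)))\<^sup>2)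
    \<le> (pick_bound (norm (value_at_zero a)) s)\<^sup>2 * (\<Sum>\<gamma> | length \<gamma> \<le> N. (cmod (w \<gamma>))\<^sup>2)"
proof -
  obtain e :: "'n list \<Rightarrow> 'k" where e: "orthonormal_on {\<beta>. length \<beta> \<le> N} e"
    using ex_orthonormal_family[OF assms(1) finite_words_le] by blast
  define q where "q = pick_bound (norm (value_at_zero a)) s"
  have "q \<ge> 0"
    using assms by (simp add: q_def pick_bound_nonneg)
  define F where "F = free_map a (\<lambda>i. scale_op (complex_of_real s) (truncated_creation N e i))"
  define S where "S = truncated_creation N e"
  define v where "v = (\<Sum>\<gamma> | length \<gamma> \<le> N. w \<gamma> *\<^sub>C e \<gamma>)"
  \<comment> \<open>With this choice the squared norm of \<open>u\<close> equals
    \<open>cinner (row_operator F u) v\<close>, so the bilinear bound turns into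
    \<open>norm u \<le> q * norm v\<close>.\<close>
  define u where "u = (\<chi> j. adjoint_op (F j) v)"
  have S: "S \<in> op_tuples"
    by (simp add: op_tuples_def truncated_creation_complex S_def)
  have F_eq: "F j = (\<Sum>\<alpha> | length \<alpha> \<le> N. scale_op (a j \<alpha> * complex_of_real s ^ length \<alpha>) (word_op S \<alpha>))" for j
    by (simp add: F_def S_def free_map_def free_eval_truncated_creation[OF e])
  have F: "F j \<in> complex_ops" for j
    unfolding F_eq using S by blast
  have "complex_of_real ((norm u)\<^sup>2) = cinner (row_operator F u) v"
    by (simp add: norm_vec_sq u_def row_operator_def cinner_sum_left cinner_adjoint_op F cinner_self)
  then have "(norm u)\<^sup>2 = cmod (cinner (row_operator F u) v)"
    by (metis norm_of_real abs_of_nonneg zero_le_power2)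
  also have "\<dots> \<le> q * (norm u * norm v)"
    unfolding F_def q_def by (rule truncated_row_bound) (use e assms in auto)
  finally have "norm u * norm u \<le> (q * norm v) * norm u"
    by (simp add: power2_eq_square mult_ac)
  then have "norm u \<le> q * norm v"
    using \<open>q \<ge> 0\<close> by (cases "norm u = 0") (auto simp: mult_le_cancel_right)
  then have u: "(norm u)\<^sup>2 \<le> q\<^sup>2 * (norm v)\<^sup>2"
    by (simp add: power_mono flip: power_mult_distrib)
  have coeff: "cinner (u $ j) (e \<beta>) =
      (\<Sum>\<alpha> | length \<alpha> + length \<beta> \<le> N. cnj (a j \<alpha>) * complex_of_real s ^ length \<alpha> * w (\<alpha> @ \<beta>))"
    if "length \<beta> \<le> N" for j \<beta>
  proof -
    have "F j (e \<beta>) = (\<Sum>\<alpha> | length \<alpha> \<le> N. (a j \<alpha> * complex_of_real s ^ length \<alpha>) *\<^sub>C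
        (if length \<alpha> + length \<beta> \<le> N then e (\<alpha> @ \<beta>) else 0))"
      by (simp add: F_eq S_def blinfun.sum_left word_truncated_creation_basis[OF e that])
    also have "\<dots> = (\<Sum>\<alpha> | length \<alpha> + length \<beta> \<le> N. (a j \<alpha> * complex_of_real s ^ length \<alpha>) *\<^sub>C e (\<alpha> @ \<beta>))"
      by (intro sum.mono_neutral_cong_right) auto
    finally have "cinner (u $ j) (e \<beta>) =
        (\<Sum>\<alpha> | length \<alpha> + length \<beta> \<le> N. cnj (a j \<alpha>) * complex_of_real s ^ length \<alpha> * cinner v (e (\<alpha> @ \<beta>)))"
      by (simp add: u_def cinner_adjoint_op_left F cinner_sum_right cinner_scaleC_right)
    also have "\<dots> = (\<Sum>\<alpha> | length \<alpha> + length \<beta> \<le> N. cnj (a j \<alpha>) * complex_of_real s ^ length \<alpha> * w (\<alpha> @ \<beta>))"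
      by (intro sum.cong refl) (simp add: v_def cinner_orthonormal_combination[OF _ e])
    finally show ?thesis .
  qed
  have "(\<Sum>j\<in>UNIV. \<Sum>\<beta> | length \<beta> \<le> N.
      (cmod (\<Sum>\<alpha> | length \<alpha> + length \<beta> \<le> N. cnj (a j \<alpha>) * complex_of_real s ^ length \<alpha> * w (\<alpha> @ \<beta>)))\<^sup>2)
    = (\<Sum>j\<in>UNIV. \<Sum>\<beta> | length \<beta> \<le> N. (cmod (cinner (u $ j) (e \<beta>)))\<^sup>2)"
    by (intro sum.cong refl) (simp add: coeff)
  also have "\<dots> \<le> (\<Sum>j\<in>UNIV. (norm (u $ j))\<^sup>2)"
    by (intro sum_mono bessel_inequality[OF _ e]) simp
  also have "\<dots> \<le> q\<^sup>2 * (norm v)\<^sup>2"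
    using u by (simp add: norm_vec_sq)
  also have "(norm v)\<^sup>2 = (\<Sum>\<gamma> | length \<gamma> \<le> N. (cmod (w \<gamma>))\<^sup>2)"
    unfolding v_def by (rule norm_orthonormal_combination[OF _ e]) simp
  finally show ?thesis
    by (simp add: q_def)
qed

text \<open>The scalar inequality holds in every coordinate, and summing over an orthonormal basis
  gives the vector version; it amounts to tensoring with the identity. Only the finitely many
  vectors \<open>g \<gamma>\<close> occur, so the dimension of \<open>'h\<close> is
  irrelevant.\<close>

lemma truncated_kernel_vector:
  fixes a :: "'m::finite \<Rightarrow> 'n::finite list \<Rightarrow> complex" and g :: "'n list \<Rightarrow> 'h::complex_hilbert"
  assumes "separable_infinite_dimensional TYPE('k::complex_hilbert)" "contractive TYPE('k) a"
    and "0 \<le> s" "s < 1"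
  shows "(\<Sum>j\<in>UNIV. \<Sum>\<beta> | length \<beta> \<le> N.
      (norm (\<Sum>\<alpha> | length \<alpha> + length \<beta> \<le> N. (cnj (a j \<alpha>) * complex_of_real s ^ length \<alpha>) *\<^sub>C g (\<alpha> @ \<beta>)))\<^sup>2)
    \<le> (pick_bound (norm (value_at_zero a)) s)\<^sup>2 * (\<Sum>\<gamma> | length \<gamma> \<le> N. (norm (g \<gamma>))\<^sup>2)"
proof -
  define q where "q = pick_bound (norm (value_at_zero a)) s"
  obtain B where B: "finite B" "orthonormal_on B (\<lambda>b. b)"
    and g: "\<And>\<gamma>. length \<gamma> \<le> N \<Longrightarrow> g \<gamma> = (\<Sum>b\<in>B. cinner (g \<gamma>) b *\<^sub>C b)"
    using ex_orthonormal_basis[of "g ` {\<gamma>. length \<gamma> \<le> N}"] by auto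
  define c where "c j \<alpha> = cnj (a j \<alpha>) * complex_of_real s ^ length \<alpha>" for j \<alpha>
  have expand: "(norm (\<Sum>\<alpha> | length \<alpha> + length \<beta> \<le> N. c j \<alpha> *\<^sub>C g (\<alpha> @ \<beta>)))\<^sup>2 =
      (\<Sum>b\<in>B. (cmod (\<Sum>\<alpha> | length \<alpha> + length \<beta> \<le> N. c j \<alpha> * cinner (g (\<alpha> @ \<beta>)) b))\<^sup>2)" for j \<beta>
  proof -
    define x where "x = (\<Sum>\<alpha> | length \<alpha> + length \<beta> \<le> N. c j \<alpha> *\<^sub>C g (\<alpha> @ \<beta>))"
    have cx: "cinner x b = (\<Sum>\<alpha> | length \<alpha> + length \<beta> \<le> N. c j \<alpha> * cinner (g (\<alpha> @ \<beta>)) b)" for b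
      by (simp add: x_def cinner_sum_left cinner_scaleC_left)
    \<comment> \<open>The combination \<open>x\<close> stays in the span of \<open>B\<close>, so
      Parseval gives an equality; Bessel would bound the left-hand side in the wrong
      direction.\<close>
    have "(\<Sum>b\<in>B. cinner x b *\<^sub>C b) =
        (\<Sum>\<alpha> | length \<alpha> + length \<beta> \<le> N. c j \<alpha> *\<^sub>C (\<Sum>b\<in>B. cinner (g (\<alpha> @ \<beta>)) b *\<^sub>C b))"
      unfolding cx scaleC_sum_left scaleC_sum_right scaleC_scaleC by (rule sum.swap)
    also have "\<dots> = x"
      unfolding x_def by (intro sum.cong refl) (simp add: g[symmetric])
    finally have "(norm x)\<^sup>2 = (\<Sum>b\<in>B. (cmod (cinner x b))\<^sup>2)"
      by (intro parseval_identity[OF B]) simp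
    then show ?thesis
      by (simp add: x_def[symmetric] cx)
  qed
  have "(\<Sum>j\<in>UNIV. \<Sum>\<beta> | length \<beta> \<le> N. (norm (\<Sum>\<alpha> | length \<alpha> + length \<beta> \<le> N. c j \<alpha> *\<^sub>C g (\<alpha> @ \<beta>)))\<^sup>2)
    = (\<Sum>j\<in>UNIV. \<Sum>b\<in>B. \<Sum>\<beta> | length \<beta> \<le> N.
        (cmod (\<Sum>\<alpha> | length \<alpha> + length \<beta> \<le> N. c j \<alpha> * cinner (g (\<alpha> @ \<beta>)) b))\<^sup>2)"
    unfolding expand by (intro sum.cong refl sum.swap)
  also have "\<dots> = (\<Sum>b\<in>B. \<Sum>j\<in>UNIV. \<Sum>\<beta> | length \<beta> \<le> N.
        (cmod (\<Sum>\<alpha> | length \<alpha> + length \<beta> \<le> N. c j \<alpha> * cinner (g (\<alpha> @ \<beta>)) b))\<^sup>2)"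
    by (rule sum.swap)
  also have "\<dots> \<le> (\<Sum>b\<in>B. q\<^sup>2 * (\<Sum>\<gamma> | length \<gamma> \<le> N. (cmod (cinner (g \<gamma>) b))\<^sup>2))"
    unfolding c_def q_def
    by (intro sum_mono truncated_kernel_scalar[OF assms, where w = "\<lambda>\<gamma>. cinner (g \<gamma>) b" for b])
  also have "\<dots> = q\<^sup>2 * (\<Sum>\<gamma> | length \<gamma> \<le> N. \<Sum>b\<in>B. (cmod (cinner (g \<gamma>) b))\<^sup>2)"
    unfolding sum_distrib_left[symmetric] by (subst sum.swap) rule
  also have "\<dots> = q\<^sup>2 * (\<Sum>\<gamma> | length \<gamma> \<le> N. (norm (g \<gamma>))\<^sup>2)"
    by (intro arg_cong2[where f = "(*)"] sum.cong refl) (simp add: parseval_identity[OF B g])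
  finally show ?thesis
    by (simp add: c_def q_def)
qed

section \<open>Evaluation on the spectral ball\<close>

lemma tendsto_adjoint_op:
  assumes "(A \<longlongrightarrow> B) G" "\<And>p. A p \<in> complex_ops" "B \<in> complex_ops"
  shows "((\<lambda>p. adjoint_op (A p)) \<longlongrightarrow> adjoint_op B) G"
proof -
  have "norm (adjoint_op (A p) - adjoint_op B) = norm (A p - B)" for p
    using assms(2,3) by (simp add: norm_adjoint_op complex_ops_diff flip: adjoint_op_diff)
  then show ?thesis
    using assms(1) by (simp add: tendsto_iff dist_norm)
qed

section \<open>Homogeneous parts and convergence of the series on the spectral ball\<close>

definition hom_part ::
  "('n::finite list \<Rightarrow> complex) \<Rightarrow> ('n \<Rightarrow> 'h::complex_hilbert \<Rightarrow>\<^sub>L 'h) \<Rightarrow> nat \<Rightarrow> ('h \<Rightarrow>\<^sub>L 'h)" where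
  "hom_part a X k = (\<Sum>\<alpha> | length \<alpha> = k. scale_op (a \<alpha>) (word_op X \<alpha>))"

definition coeff_norm :: "('n::finite list \<Rightarrow> complex) \<Rightarrow> nat \<Rightarrow> real" where
  "coeff_norm a k = sqrt (\<Sum>\<alpha> | length \<alpha> = k. (cmod (a \<alpha>))\<^sup>2)"

lemma coeff_norm_nonneg [simp]: "coeff_norm a k \<ge> 0"
  by (simp add: coeff_norm_def sum_nonneg)

lemma hom_part_complex: "X \<in> op_tuples \<Longrightarrow> hom_part a X k \<in> complex_ops"
  unfolding hom_part_def by blast

lemma adjoint_hom_part_apply:
  "X \<in> op_tuples \<Longrightarrow>
    adjoint_op (hom_part a X k) h = (\<Sum>\<alpha> | length \<alpha> = k. cnj (a \<alpha>) *\<^sub>C adjoint_op (word_op X \<alpha>) h)"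
  unfolding hom_part_def
  by (subst adjoint_op_sum) (auto simp: blinfun.sum_left adjoint_op_scale_op complex_ops_word_op)

text \<open>Cauchy-Schwarz over words of length \<open>k\<close> is applied to the adjoint, since
  \<open>power_norm\<close> controls the column of adjoint words.\<close>

lemma norm_hom_part_le:
  assumes "X \<in> op_tuples"
  shows "norm (hom_part a X k) \<le> coeff_norm a k * sqrt (power_norm X k)"
  unfolding norm_adjoint_op[OF hom_part_complex[OF assms], symmetric]
proof (rule norm_blinfun_bound)
  fix h
  have "norm (adjoint_op (hom_part a X k) h) \<le>
      (\<Sum>\<alpha> | length \<alpha> = k. \<bar>cmod (a \<alpha>)\<bar> * \<bar>norm (adjoint_op (word_op X \<alpha>) h)\<bar>)"
    unfolding adjoint_hom_part_apply[OF assms]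
    by (rule order_trans[OF norm_sum]) (simp add: norm_scaleC)
  also have "\<dots> \<le> L2_set (\<lambda>\<alpha>. cmod (a \<alpha>)) {\<alpha>. length \<alpha> = k} *
      L2_set (\<lambda>\<alpha>. norm (adjoint_op (word_op X \<alpha>) h)) {\<alpha>. length \<alpha> = k}"
    by (rule L2_set_mult_ineq)
  also have "\<dots> = coeff_norm a k * sqrt (energy X k h)"
    by (simp add: L2_set_def coeff_norm_def energy_def)
  also have "\<dots> \<le> coeff_norm a k * sqrt (power_norm X k * (norm h)\<^sup>2)"
    by (intro mult_left_mono real_sqrt_le_mono energy_le assms) simp
  finally show "norm (adjoint_op (hom_part a X k) h) \<le> coeff_norm a k * sqrt (power_norm X k) * norm h"
    by (simp add: real_sqrt_mult)
qed simp

lemma summable_coeff_bound: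
  assumes "free_holomorphic a" "0 < t" "t < 1" "D \<ge> 0"
  shows "summable (\<lambda>k. coeff_norm a k * sqrt (D * t ^ k))"
proof -
  \<comment> \<open>The fourth root of \<open>t\<close> splits the decay of
    \<open>sqrt (t ^ k)\<close>, which is \<open>y ^ (2 * k)\<close>: one factor
    \<open>y ^ k\<close> absorbs the coefficient growth, eventually at most
    \<open>(1 / y) ^ k\<close>, and the other makes the series converge.\<close>
  define y where "y = sqrt (sqrt t)"
  have y: "0 < y" "y < 1"
    using assms by (simp_all add: y_def)
  have sqrt_t: "sqrt t = y\<^sup>2"
    using assms by (simp add: y_def)
  have "limsup (\<lambda>k. ereal (root (2 * k) (\<Sum>\<alpha> | length \<alpha> = k. (cmod (a \<alpha>))\<^sup>2))) < ereal (1 / y)"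
    using assms(1) y unfolding free_holomorphic_def by (auto elim: le_less_trans simp: one_ereal_def)
  from Limsup_lessD[OF this]
  have ev: "\<forall>\<^sub>F k in sequentially. root (2 * k) (\<Sum>\<alpha> | length \<alpha> = k. (cmod (a \<alpha>))\<^sup>2) < 1 / y"
    by simp
  show ?thesis
  proof (rule summable_comparison_test_ev)
    show "summable (\<lambda>k. sqrt D * y ^ k)"
      using y by (intro summable_mult summable_geometric) simp
    show "\<forall>\<^sub>F k in sequentially. norm (coeff_norm a k * sqrt (D * t ^ k)) \<le> sqrt D * y ^ k"
      using ev eventually_gt_at_top[of 0]
    proof eventually_elim
      case (elim k)
      define Q where "Q = (\<Sum>\<alpha> | length \<alpha> = k. (cmod (a \<alpha>))\<^sup>2)"
      have "Q \<ge> 0"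
        by (simp add: Q_def sum_nonneg)
      have "Q = root (2 * k) Q ^ (2 * k)"
        using \<open>Q \<ge> 0\<close> elim(2) by (intro real_root_pow_pos2[symmetric]) auto
      also have "\<dots> \<le> (1 / y) ^ (2 * k)"
        using elim \<open>Q \<ge> 0\<close> by (intro power_mono) (auto simp: Q_def)
      also have "\<dots> = ((1 / y) ^ k)\<^sup>2"
        by (simp add: power_mult[symmetric] mult.commute)
      finally have "coeff_norm a k \<le> (1 / y) ^ k"
        unfolding coeff_norm_def Q_def[symmetric] using y by (intro real_le_lsqrt) auto
      moreover have "sqrt (D * t ^ k) = sqrt D * (y\<^sup>2) ^ k"
        by (simp add: real_sqrt_mult real_sqrt_power sqrt_t)
      ultimately have "coeff_norm a k * sqrt (D * t ^ k) \<le> (1 / y) ^ k * (sqrt D * (y\<^sup>2) ^ k)"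
        using assms y by (simp add: mult_right_mono)
      also have "\<dots> = sqrt D * ((1 / y) * y\<^sup>2) ^ k"
        by (simp only: power_mult_distrib mult_ac)
      also have "(1 / y) * y\<^sup>2 = y"
        using y by (simp add: power2_eq_square)
      finally show ?case
        using assms by simp
    qed
  qed
qed

lemma spectral_ball_geometric_bound:
  assumes "T \<in> spectral_ball"
  obtains D t where "D > 0" "0 < t" "t < 1" "\<And>k. power_norm T k \<le> D * t ^ k"
proof -
  have T: "T \<in> op_tuples"
    using assms by (simp add: spectral_ball_def)
  obtain m t where m: "m \<ge> 1" "0 < t" "t < 1" "power_norm T m < t ^ m"
    using spectral_ball_power_norm[OF assms] .
  define R where "R = max t (power_norm T 1)"
  have "power_norm T k \<le> (R / t) ^ m * t ^ k" for k
    by (rule submultiplicative_geometric_bound)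
      (use m T in \<open>auto simp: R_def power_norm_add power_norm_0\<close>)
  moreover have "(R / t) ^ m > 0"
    using m by (simp add: R_def)
  ultimately show ?thesis
    using m that by blast
qed

lemma free_eval_hom_part: "free_eval a X = (\<Sum>k. hom_part a X k)"
  by (simp add: free_eval_def hom_part_def)

lemma norm_hom_part_geometric:
  assumes "X \<in> op_tuples" "power_norm X k \<le> D * t ^ k"
  shows "norm (hom_part a X k) \<le> coeff_norm a k * sqrt (D * t ^ k)"
  by (rule order_trans[OF norm_hom_part_le[OF assms(1)]])
    (intro mult_left_mono real_sqrt_le_mono assms coeff_norm_nonneg)

lemma summable_hom_part:
  assumes "free_holomorphic a" "T \<in> spectral_ball"
  shows "summable (hom_part a T)"
proof -
  have T: "T \<in> op_tuples"
    using assms by (simp add: spectral_ball_def)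
  obtain D t where D: "D > 0" "0 < t" "t < 1" and bound: "\<And>k. power_norm T k \<le> D * t ^ k"
    using spectral_ball_geometric_bound[OF assms(2)] by blast
  show ?thesis
    by (rule summable_comparison_test'[OF summable_coeff_bound[OF assms(1) D(2,3) less_imp_le[OF D(1)]]])
      (rule norm_hom_part_geometric[OF T bound])
qed

lemma free_eval_LIMSEQ:
  assumes "free_holomorphic a" "T \<in> spectral_ball"
  shows "(\<lambda>n. \<Sum>k\<le>n. hom_part a T k) \<longlonglongrightarrow> free_eval a T"
  unfolding free_eval_hom_part by (rule summable_LIMSEQ'[OF summable_hom_part[OF assms]])

lemma free_eval_complex:
  assumes "free_holomorphic a" "T \<in> spectral_ball"
  shows "free_eval a T \<in> complex_ops"
proof (rule closed_sequentially[OF closed_complex_ops _ free_eval_LIMSEQ[OF assms]])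
  show "(\<Sum>k\<le>n. hom_part a T k) \<in> complex_ops" for n
    using assms(2) by (auto simp: spectral_ball_def intro!: hom_part_complex)
qed

section \<open>The renormed space\<close>

text \<open>In the equivalent norm \<open>renorm T w\<close>, the column of adjoints of a tuple of joint spectral
  radius less than \<open>sqrt w\<close> becomes a strict contraction (Rota's model).\<close>

definition renorm :: "('n::finite \<Rightarrow> 'h::complex_hilbert \<Rightarrow>\<^sub>L 'h) \<Rightarrow> real \<Rightarrow> 'h \<Rightarrow> real" where
  "renorm T w h = (\<Sum>k. energy T k h / w ^ k)"

context
  fixes T :: "'n::finite \<Rightarrow> 'h::complex_hilbert \<Rightarrow>\<^sub>L 'h" and D t w :: real
  assumes T: "T \<in> op_tuples" and D: "D > 0" and t: "0 < t" "t < w"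
    and bound: "\<And>k. power_norm T k \<le> D * t ^ k"
begin

lemma renorm_term_le: "energy T k h / w ^ k \<le> D * (norm h)\<^sup>2 * (t / w) ^ k"
proof -
  have "energy T k h \<le> D * t ^ k * (norm h)\<^sup>2"
    by (rule order_trans[OF energy_le[OF T]]) (intro mult_right_mono bound, simp)
  then have "energy T k h / w ^ k \<le> D * t ^ k * (norm h)\<^sup>2 / w ^ k"
    using t by (intro divide_right_mono) auto
  then show ?thesis
    by (simp add: power_divide mult_ac)
qed

lemma renorm_summable: "summable (\<lambda>k. energy T k h / w ^ k)"
proof (rule summable_comparison_test'[where N = 0])
  show "summable (\<lambda>k. D * (norm h)\<^sup>2 * (t / w) ^ k)"
    using t by (intro summable_mult summable_geometric) simp
  show "norm (energy T k h / w ^ k) \<le> D * (norm h)\<^sup>2 * (t / w) ^ k" for k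
    using renorm_term_le t by simp
qed

lemma renorm_le: "renorm T w h \<le> D / (1 - t / w) * (norm h)\<^sup>2"
proof -
  have "renorm T w h \<le> (\<Sum>k. D * (norm h)\<^sup>2 * (t / w) ^ k)"
    unfolding renorm_def using t
    by (intro suminf_le renorm_term_le renorm_summable summable_mult summable_geometric) simp
  also have "\<dots> = D * (norm h)\<^sup>2 * (1 / (1 - t / w))"
    using t by (subst suminf_mult) (auto intro!: summable_geometric simp: suminf_geometric)
  finally show ?thesis
    by (simp add: mult_ac)
qed

lemma partial_renorm_le: "(\<Sum>k\<le>L. energy T k h / w ^ k) \<le> renorm T w h"
  unfolding renorm_def using t
  by (intro sum_le_suminf renorm_summable) auto

lemma norm_le_renorm: "(norm h)\<^sup>2 \<le> renorm T w h"
  using partial_renorm_le[of h 0] by (simp add: energy_def)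

end

text \<open>In the vector inequality the factors \<open>s ^ length \<alpha>\<close> cancel the
  weight of \<alpha> and leave that of \<beta>. Truncation at total length \<open>M\<close>
  produces, for the word \<beta>, only the partial sum of degree \<open>M - length \<beta>\<close>.
  The two cutoffs are therefore separated: output words are restricted to length \<open>L\<close>,
  then \<open>M\<close> tends to infinity with \<open>L\<close> fixed, and finally \<open>L\<close>
  does.\<close>

lemma renorm_contraction:
  fixes a :: "'m::finite \<Rightarrow> 'n::finite list \<Rightarrow> complex" and T :: "'n \<Rightarrow> 'h::complex_hilbert \<Rightarrow>\<^sub>L 'h"
  assumes K: "separable_infinite_dimensional TYPE('k::complex_hilbert)" "contractive TYPE('k) a"
    and hol: "\<And>j. free_holomorphic (a j)"
    and ball: "T \<in> spectral_ball" and D: "D > 0" and t: "0 < t" "t < s\<^sup>2"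
    and s: "0 < s" "s < 1" and bound: "\<And>k. power_norm T k \<le> D * t ^ k"
  shows "(\<Sum>j\<in>UNIV. renorm T (s\<^sup>2) (adjoint_op (free_map a T j) h))
    \<le> (pick_bound (norm (value_at_zero a)) s)\<^sup>2 * renorm T (s\<^sup>2) h"
proof -
  define q where "q = pick_bound (norm (value_at_zero a)) s"
  have T: "T \<in> op_tuples"
    using ball by (simp add: spectral_ball_def)
  note summable = renorm_summable[OF T D t bound] and partial_le = partial_renorm_le[OF T D t bound]
  define r where "r = complex_of_real (1 / s)"
  define p where "p j n h = adjoint_op (\<Sum>k\<le>n. hom_part (a j) T k) h" for j n h
  have partial: "(\<Sum>\<gamma> | length \<gamma> \<le> L. (norm (r ^ length \<gamma> *\<^sub>C adjoint_op (word_op T \<gamma>) x))\<^sup>2)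
      = (\<Sum>k\<le>L. energy T k x / (s\<^sup>2) ^ k)" for L x
  proof -
    have "(norm (r ^ k *\<^sub>C y))\<^sup>2 = (norm y)\<^sup>2 / (s\<^sup>2) ^ k" for k and y :: 'h
      using s by (simp add: r_def norm_scaleC norm_divide norm_power power_mult_distrib power_divide
          power_mult[symmetric] mult.commute)
    then show ?thesis
      unfolding sum_words_le energy_def sum_divide_distrib by (intro sum.cong refl) auto
  qed
  have p_eq: "(\<Sum>\<alpha> | length \<alpha> + length \<beta> \<le> M. (cnj (a j \<alpha>) * complex_of_real s ^ length \<alpha>) *\<^sub>C
        r ^ length (\<alpha> @ \<beta>) *\<^sub>C adjoint_op (word_op T (\<alpha> @ \<beta>)) h)
      = r ^ length \<beta> *\<^sub>C adjoint_op (word_op T \<beta>) (p j (M - length \<beta>) h)"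
    if "length \<beta> \<le> M" for j \<beta> M
  proof -
    have set: "{\<alpha> :: 'n list. length \<alpha> + length \<beta> \<le> M} = {\<alpha>. length \<alpha> \<le> M - length \<beta>}"
      using that by auto
    have "p j n h = (\<Sum>\<alpha> | length \<alpha> \<le> n. cnj (a j \<alpha>) *\<^sub>C adjoint_op (word_op T \<alpha>) h)" for n
      unfolding p_def sum_words_le
      by (subst adjoint_op_sum) (auto simp: T hom_part_complex blinfun.sum_left adjoint_hom_part_apply)
    moreover have "adjoint_op (word_op T \<beta>) (c *\<^sub>C x) = c *\<^sub>C adjoint_op (word_op T \<beta>) x" for c x
      using T by (intro complex_opsD) blast
    ultimately have "r ^ length \<beta> *\<^sub>C adjoint_op (word_op T \<beta>) (p j (M - length \<beta>) h)
        = (\<Sum>\<alpha> | length \<alpha> \<le> M - length \<beta>.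
            (r ^ length \<beta> * cnj (a j \<alpha>)) *\<^sub>C adjoint_op (word_op T (\<alpha> @ \<beta>)) h)"
      by (simp add: blinfun.sum_right scaleC_sum_right scaleC_scaleC adjoint_op_word_op_append T)
    also have "\<dots> = (\<Sum>\<alpha> | length \<alpha> \<le> M - length \<beta>. (cnj (a j \<alpha>) * complex_of_real s ^ length \<alpha>) *\<^sub>C
        r ^ length (\<alpha> @ \<beta>) *\<^sub>C adjoint_op (word_op T (\<alpha> @ \<beta>)) h)"
    proof (intro sum.cong refl)
      fix \<alpha> :: "'n list"
      have "complex_of_real s ^ length \<alpha> * r ^ length \<alpha> = 1"
        using s by (simp add: r_def flip: power_mult_distrib of_real_mult)
      then have "cnj (a j \<alpha>) * complex_of_real s ^ length \<alpha> * r ^ length (\<alpha> @ \<beta>) = r ^ length \<beta> * cnj (a j \<alpha>)"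
        by (simp add: power_add mult_ac)
      then show "(r ^ length \<beta> * cnj (a j \<alpha>)) *\<^sub>C adjoint_op (word_op T (\<alpha> @ \<beta>)) h
          = (cnj (a j \<alpha>) * complex_of_real s ^ length \<alpha>) *\<^sub>C
            r ^ length (\<alpha> @ \<beta>) *\<^sub>C adjoint_op (word_op T (\<alpha> @ \<beta>)) h"
        by (simp only: scaleC_scaleC)
    qed
    finally show ?thesis
      unfolding set ..
  qed
  have kernel: "(\<Sum>j\<in>UNIV. \<Sum>\<beta> | length \<beta> \<le> L.
      (norm (r ^ length \<beta> *\<^sub>C adjoint_op (word_op T \<beta>) (p j (M - length \<beta>) h)))\<^sup>2)
    \<le> q\<^sup>2 * renorm T (s\<^sup>2) h" if "L \<le> M" for L M
  proof -
    have "(\<Sum>j\<in>UNIV. \<Sum>\<beta> | length \<beta> \<le> L.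
        (norm (r ^ length \<beta> *\<^sub>C adjoint_op (word_op T \<beta>) (p j (M - length \<beta>) h)))\<^sup>2)
      \<le> (\<Sum>j\<in>UNIV. \<Sum>\<beta> | length \<beta> \<le> M.
        (norm (r ^ length \<beta> *\<^sub>C adjoint_op (word_op T \<beta>) (p j (M - length \<beta>) h)))\<^sup>2)"
      using that by (intro sum_mono sum_mono2) auto
    also have "\<dots> = (\<Sum>j\<in>UNIV. \<Sum>\<beta> | length \<beta> \<le> M. (norm (\<Sum>\<alpha> | length \<alpha> + length \<beta> \<le> M.
        (cnj (a j \<alpha>) * complex_of_real s ^ length \<alpha>) *\<^sub>C
        r ^ length (\<alpha> @ \<beta>) *\<^sub>C adjoint_op (word_op T (\<alpha> @ \<beta>)) h))\<^sup>2)"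
      by (intro sum.cong refl) (simp only: p_eq mem_Collect_eq)
    also have "\<dots> \<le> q\<^sup>2 * (\<Sum>\<gamma> | length \<gamma> \<le> M. (norm (r ^ length \<gamma> *\<^sub>C adjoint_op (word_op T \<gamma>) h))\<^sup>2)"
      unfolding q_def
      by (rule truncated_kernel_vector[OF K, where g = "\<lambda>\<gamma>. r ^ length \<gamma> *\<^sub>C adjoint_op (word_op T \<gamma>) h"])
        (use s in auto)
    also have "\<dots> \<le> q\<^sup>2 * renorm T (s\<^sup>2) h"
      unfolding partial by (intro mult_left_mono partial_le) simp
    finally show ?thesis .
  qed
  have p_lim: "(\<lambda>n. p j n h) \<longlonglongrightarrow> adjoint_op (free_map a T j) h" for j
    unfolding p_def free_map_def
    by (intro blinfun.tendsto tendsto_const tendsto_adjoint_op free_eval_LIMSEQ free_eval_complex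
        complex_ops_sum hom_part_complex hol ball T)
  have "(\<Sum>j\<in>UNIV. \<Sum>k\<le>L. energy T k (adjoint_op (free_map a T j) h) / (s\<^sup>2) ^ k)
      \<le> q\<^sup>2 * renorm T (s\<^sup>2) h" for L
    unfolding partial[symmetric]
  proof (rule LIMSEQ_le_const2)
    show "(\<lambda>M. \<Sum>j\<in>UNIV. \<Sum>\<beta> | length \<beta> \<le> L.
        (norm (r ^ length \<beta> *\<^sub>C adjoint_op (word_op T \<beta>) (p j (M - length \<beta>) h)))\<^sup>2)
      \<longlonglongrightarrow> (\<Sum>j\<in>UNIV. \<Sum>\<beta> | length \<beta> \<le> L.
        (norm (r ^ length \<beta> *\<^sub>C adjoint_op (word_op T \<beta>) (adjoint_op (free_map a T j) h)))\<^sup>2)"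
      by (intro tendsto_sum tendsto_power tendsto_norm bounded_linear.tendsto[OF bounded_linear_scaleC]
          blinfun.tendsto tendsto_const seq_offset_neg p_lim)
    show "\<exists>N. \<forall>M\<ge>N. (\<Sum>j\<in>UNIV. \<Sum>\<beta> | length \<beta> \<le> L.
        (norm (r ^ length \<beta> *\<^sub>C adjoint_op (word_op T \<beta>) (p j (M - length \<beta>) h)))\<^sup>2)
      \<le> q\<^sup>2 * renorm T (s\<^sup>2) h"
      using kernel by blast
  qed
  moreover have "(\<lambda>L. \<Sum>j\<in>UNIV. \<Sum>k\<le>L. energy T k (adjoint_op (free_map a T j) h) / (s\<^sup>2) ^ k)
      \<longlonglongrightarrow> (\<Sum>j\<in>UNIV. renorm T (s\<^sup>2) (adjoint_op (free_map a T j) h))"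
    unfolding renorm_def by (intro tendsto_sum summable_LIMSEQ' summable)
  ultimately have "(\<Sum>j\<in>UNIV. renorm T (s\<^sup>2) (adjoint_op (free_map a T j) h)) \<le> q\<^sup>2 * renorm T (s\<^sup>2) h"
    by (intro LIMSEQ_le_const2[where a = "q\<^sup>2 * renorm T (s\<^sup>2) h"]) auto
  then show ?thesis
    by (simp add: q_def)
qed

text \<open>Taking adjoints reverses composition, so the first letter of a word acts first on
  \<open>h\<close> and can be peeled off by induction. The functional \<open>\<nu>\<close> is
  iterated itself, without returning to the original norm between steps.\<close>

lemma words_contraction:
  fixes F :: "'m::finite \<Rightarrow> 'h::complex_hilbert \<Rightarrow>\<^sub>L 'h"
  assumes F: "F \<in> op_tuples" and "0 \<le> c"
    and step: "\<And>h. (\<Sum>j\<in>UNIV. \<nu> (adjoint_op (F j) h)) \<le> c * \<nu> h"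
  shows "(\<Sum>\<beta> | length \<beta> = k. \<nu> (adjoint_op (word_op F \<beta>) h)) \<le> c ^ k * (\<nu> h :: real)"
proof (induction k arbitrary: h)
  case (Suc k)
  have F': "F j \<in> complex_ops" for j
    using F by (simp add: op_tuples_def)
  have "(\<Sum>\<beta> | length \<beta> = Suc k. \<nu> (adjoint_op (word_op F \<beta>) h))
      = (\<Sum>j\<in>UNIV. \<Sum>\<beta> | length \<beta> = k. \<nu> (adjoint_op (word_op F \<beta>) (adjoint_op (F j) h)))"
    unfolding sum_words_Suc by (simp add: adjoint_op_compose F' F complex_ops_word_op)
  also have "\<dots> \<le> (\<Sum>j\<in>UNIV. c ^ k * \<nu> (adjoint_op (F j) h))"
    by (intro sum_mono Suc)
  also have "\<dots> \<le> c ^ k * (c * \<nu> h)"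
    unfolding sum_distrib_left[symmetric] using \<open>0 \<le> c\<close> by (intro mult_left_mono step) simp
  finally show ?case
    by (simp add: mult_ac)
qed simp

text \<open>The renormed quantity dominates the squared norm and is at most \<open>C\<close> times
  it. The two comparisons frame the \<open>k\<close>-fold contraction, so \<open>C\<close> does not
  grow with \<open>k\<close>.\<close>

lemma free_map_spectral_ball:
  fixes a :: "'m::finite \<Rightarrow> 'n::finite list \<Rightarrow> complex" and T :: "'n \<Rightarrow> 'h::complex_hilbert \<Rightarrow>\<^sub>L 'h"
  assumes K: "separable_infinite_dimensional TYPE('k::complex_hilbert)" "contractive TYPE('k) a"
    and hol: "\<And>j. free_holomorphic (a j)" and zero: "norm (value_at_zero a) < 1"
    and ball: "T \<in> spectral_ball"
  shows "free_map a T \<in> spectral_ball"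
proof -
  have T: "T \<in> op_tuples"
    using ball by (simp add: spectral_ball_def)
  obtain D t where D: "D > 0" and t: "0 < t" "t < 1" and bound: "\<And>k. power_norm T k \<le> D * t ^ k"
    using spectral_ball_geometric_bound[OF ball] by blast
  \<comment> \<open>The square of \<open>s\<close> is the midpoint of \<open>t\<close> and 1: above
    \<open>t\<close> for convergence of the renorming series, below 1 for the Schwarz-Pick
    gain.\<close>
  define s where "s = sqrt ((1 + t) / 2)"
  have s: "0 < s" "s < 1" "t < s\<^sup>2"
    using t by (auto simp: s_def)
  define q where "q = pick_bound (norm (value_at_zero a)) s"
  have q: "0 \<le> q" "q < 1"
    using s zero by (auto simp: q_def pick_bound_nonneg pick_bound_less_1)
  define C where "C = D / (1 - t / s\<^sup>2)"
  have "C > 0"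
    using D s t by (simp add: C_def)
  have F: "free_map a T \<in> op_tuples"
    by (simp add: op_tuples_def free_map_def free_eval_complex hol ball)
  have "power_norm (free_map a T) k \<le> C * (q\<^sup>2) ^ k" for k
  proof (rule power_norm_le[OF F])
    fix h
    have "energy (free_map a T) k h
        \<le> (\<Sum>\<beta> | length \<beta> = k. renorm T (s\<^sup>2) (adjoint_op (word_op (free_map a T) \<beta>) h))"
      unfolding energy_def by (intro sum_mono norm_le_renorm[OF T D t(1) s(3) bound])
    also have "\<dots> \<le> (q\<^sup>2) ^ k * renorm T (s\<^sup>2) h"
      unfolding q_def
      by (intro words_contraction F renorm_contraction[OF K hol ball D t(1) s(3) s(1,2) bound]) simp
    also have "\<dots> \<le> (q\<^sup>2) ^ k * (C * (norm h)\<^sup>2)"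
      unfolding C_def by (intro mult_left_mono renorm_le[OF T D t(1) s(3) bound]) simp
    finally show "energy (free_map a T) k h \<le> C * (q\<^sup>2) ^ k * (norm h)\<^sup>2"
      by (simp add: mult_ac)
  qed (use \<open>C > 0\<close> in simp)
  then have "joint_spectral_radius (free_map a T) \<le> q"
    using F \<open>C > 0\<close> q by (intro joint_spectral_radius_le) auto
  then show ?thesis
    using F q by (simp add: spectral_ball_def)
qed

section \<open>Continuity\<close>

lemma bounded_linear_scale_op: "bounded_linear (scale_op c)"
proof (rule bounded_linear_intro[where K = "cmod c"])
  fix A B :: "'h::complex_hilbert \<Rightarrow>\<^sub>L 'h" and r :: real
  show "scale_op c (A + B) = scale_op c A + scale_op c B"
    by (rule blinfun_eqI) (simp add: blinfun.add_left scaleC_add_right)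
  show "scale_op c (r *\<^sub>R A) = r *\<^sub>R scale_op c A"
    by (rule blinfun_eqI) (simp add: blinfun.scaleR_left linear_simps(5)[OF bounded_linear_scaleC])
  show "norm (scale_op c A) \<le> norm A * cmod c"
  proof (rule norm_blinfun_bound)
    show "norm (scale_op c A h) \<le> norm A * cmod c * norm h" for h
      using mult_left_mono[OF norm_blinfun[of A h], of "cmod c"] by (simp add: norm_scaleC mult_ac)
  qed simp
qed

lemma tendsto_word_op:
  assumes "\<And>i. ((\<lambda>p. Y p i) \<longlongrightarrow> T i) G"
  shows "((\<lambda>p. word_op (Y p) \<alpha>) \<longlongrightarrow> word_op T \<alpha>) G"
  by (induction \<alpha>)
    (auto intro!: assms bounded_bilinear.tendsto[OF bounded_bilinear_blinfun_compose])

lemma tendsto_power_norm: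
  assumes "\<And>i. ((\<lambda>p. Y p i) \<longlongrightarrow> T i) G" "\<And>p. Y p \<in> op_tuples" "T \<in> op_tuples"
  shows "((\<lambda>p. power_norm (Y p) k) \<longlongrightarrow> power_norm T k) G"
  unfolding power_norm_def
  by (intro tendsto_norm tendsto_sum bounded_bilinear.tendsto[OF bounded_bilinear_blinfun_compose]
      tendsto_adjoint_op tendsto_word_op complex_ops_word_op assms)

lemma tendsto_hom_part:
  assumes "\<And>i. ((\<lambda>p. Y p i) \<longlongrightarrow> T i) G"
  shows "((\<lambda>p. hom_part a (Y p) k) \<longlongrightarrow> hom_part a T k) G"
  unfolding hom_part_def
  by (intro tendsto_sum bounded_linear.tendsto[OF bounded_linear_scale_op] tendsto_word_op assms)

text \<open>Since the geometric bound on \<open>power_norm\<close> depends only on its first and \<open>m\<close>-th values, it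
  holds uniformly near \<open>T\<close>, and the series converges uniformly there.\<close>

lemma tendsto_free_eval:
  assumes hol: "free_holomorphic a" and lim: "\<And>i. ((\<lambda>p. Y p i) \<longlongrightarrow> T i) G"
    and Y: "\<And>p. Y p \<in> op_tuples" and ball: "T \<in> spectral_ball"
  shows "((\<lambda>p. free_eval a (Y p)) \<longlongrightarrow> free_eval a T) G"
proof -
  have T: "T \<in> op_tuples"
    using ball by (simp add: spectral_ball_def)
  obtain m t where m: "m \<ge> 1" "0 < t" "t < 1" "power_norm T m < t ^ m"
    using spectral_ball_power_norm[OF ball] .
  \<comment> \<open>The added 1 leaves room for nearby tuples, so that \<open>R\<close>, and hence
    \<open>D\<close>, serves every \<open>p\<close> in \<open>S\<close>; the maximum ensures
    \<open>t \<le> R\<close>.\<close>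
  define R where "R = max t (power_norm T 1 + 1)"
  define D where "D = (R / t) ^ m"
  have "D \<ge> 0"
    using m by (simp add: D_def R_def)
  define S where "S = {p. power_norm (Y p) m < t ^ m \<and> power_norm (Y p) 1 < power_norm T 1 + 1}"
  have near: "\<forall>\<^sub>F p in G. p \<in> S"
    unfolding S_def mem_Collect_eq
    by (intro eventually_conj order_tendstoD(2)[OF tendsto_power_norm[OF lim Y T]])
      (use m in auto)
  have uniform: "uniform_limit S (\<lambda>n p. \<Sum>k<n. hom_part a (Y p) k) (\<lambda>p. free_eval a (Y p)) sequentially"
    unfolding free_eval_hom_part
  proof (rule Weierstrass_m_test)
    show "summable (\<lambda>k. coeff_norm a k * sqrt (D * t ^ k))"
      using hol m(2,3) \<open>D \<ge> 0\<close> by (rule summable_coeff_bound)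
    show "norm (hom_part a (Y p) k) \<le> coeff_norm a k * sqrt (D * t ^ k)" if "p \<in> S" for k p
    proof (rule norm_hom_part_geometric[OF Y])
      show "power_norm (Y p) k \<le> D * t ^ k"
        unfolding D_def
        by (rule submultiplicative_geometric_bound)
          (use m Y that in \<open>auto simp: R_def S_def power_norm_add power_norm_0\<close>)
    qed
  qed
  have series: "(\<lambda>n. \<Sum>k<n. hom_part a T k) \<longlonglongrightarrow> free_eval a T"
    unfolding free_eval_hom_part by (rule summable_LIMSEQ[OF summable_hom_part[OF hol ball]])
  have "\<forall>\<^sub>F n in sequentially. ((\<lambda>p. \<Sum>k<n. hom_part a (Y p) k) \<longlongrightarrow> (\<Sum>k<n. hom_part a T k)) G"
    by (intro always_eventually allI tendsto_sum tendsto_hom_part lim)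
  then show ?thesis
    by (rule swap_uniform_limit'[OF _ series uniform near trivial_limit_sequentially])
qed

section \<open>Passing between the tuple norm and entrywise convergence\<close>

lemma norm_le_tuple_norm:
  assumes "X \<in> op_tuples"
  shows "norm (X i) \<le> tuple_norm X"
proof -
  have X: "X i \<in> complex_ops" for i
    using assms by (simp add: op_tuples_def)
  have "norm (adjoint_op (X i)) \<le> tuple_norm X"
  proof (rule norm_blinfun_bound)
    fix h
    have "(norm (adjoint_op (X i) h))\<^sup>2 \<le> (\<Sum>i\<in>UNIV. (norm (adjoint_op (X i) h))\<^sup>2)"
      by (rule member_le_sum) auto
    also have "\<dots> \<le> norm (\<Sum>i\<in>UNIV. X i o\<^sub>L adjoint_op (X i)) * (norm h)\<^sup>2"
      by (rule column_le_row_norm) (rule X)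
    also have "\<dots> = (tuple_norm X * norm h)\<^sup>2"
      by (simp add: tuple_norm_def power_mult_distrib)
    finally show "norm (adjoint_op (X i) h) \<le> tuple_norm X * norm h"
      by (rule power2_le_imp_le) (simp add: tuple_norm_def)
  qed (simp add: tuple_norm_def)
  then show ?thesis
    by (simp add: norm_adjoint_op X)
qed

lemma tendsto_tuple_norm_zero:
  fixes Z :: "'p \<Rightarrow> 'm::finite \<Rightarrow> 'h::complex_hilbert \<Rightarrow>\<^sub>L 'h"
  assumes "\<And>j. ((\<lambda>p. Z p j) \<longlongrightarrow> 0) G" "\<And>p. Z p \<in> op_tuples"
  shows "((\<lambda>p. tuple_norm (Z p)) \<longlongrightarrow> 0) G"
proof -
  have "((\<lambda>p. tuple_norm (Z p)) \<longlongrightarrow>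
      sqrt (norm (\<Sum>j\<in>(UNIV :: 'm set). (0 :: 'h \<Rightarrow>\<^sub>L 'h) o\<^sub>L adjoint_op (0 :: 'h \<Rightarrow>\<^sub>L 'h)))) G"
    unfolding tuple_norm_def
    by (intro tendsto_real_sqrt tendsto_norm tendsto_sum tendsto_adjoint_op assms(1)
        bounded_bilinear.tendsto[OF bounded_bilinear_blinfun_compose])
      (use assms(2) in \<open>auto simp: op_tuples_def complex_ops_def\<close>)
  then show ?thesis
    by simp
qed

lemma op_tuples_diff: "X \<in> op_tuples \<Longrightarrow> Y \<in> op_tuples \<Longrightarrow> (\<lambda>i. X i - Y i) \<in> op_tuples"
  by (auto simp: op_tuples_def)

lemma free_map_continuous:
  fixes a :: "'m::finite \<Rightarrow> 'n::finite list \<Rightarrow> complex"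
  assumes hol: "\<And>j. free_holomorphic (a j)"
  shows "tuple_continuous_on (spectral_ball :: ('n \<Rightarrow> 'h::complex_hilbert \<Rightarrow>\<^sub>L 'h) set) (free_map a)"
proof (rule ccontr)
  assume "\<not> ?thesis"
  then obtain T :: "'n \<Rightarrow> 'h \<Rightarrow>\<^sub>L 'h" and \<epsilon> where ball: "T \<in> spectral_ball" and "\<epsilon> > 0"
    and "\<And>\<delta>. \<delta> > 0 \<Longrightarrow> \<exists>T'\<in>spectral_ball. tuple_norm (\<lambda>i. T' i - T i) < \<delta> \<and>
      \<not> tuple_norm (\<lambda>j. free_map a T' j - free_map a T j) < \<epsilon>"
    unfolding tuple_continuous_on_def by blast
  \<comment> \<open>Failure of continuity is sampled at \<delta> = 1 / (p + 1), giving a sequence to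
    which the filter statement \<open>tendsto_free_eval\<close> applies.\<close>
  then have "\<exists>T'\<in>spectral_ball. tuple_norm (\<lambda>i. T' i - T i) < 1 / real (Suc p) \<and>
      \<not> tuple_norm (\<lambda>j. free_map a T' j - free_map a T j) < \<epsilon>" for p
    by simp
  then obtain Y where Y: "\<And>p. Y p \<in> spectral_ball"
    and close: "\<And>p. tuple_norm (\<lambda>i. Y p i - T i) < 1 / real (Suc p)"
    and far: "\<And>p. \<not> tuple_norm (\<lambda>j. free_map a (Y p) j - free_map a T j) < \<epsilon>"
    by metis
  have tuples: "T \<in> op_tuples" "Y p \<in> op_tuples" for p
    using ball Y by (auto simp: spectral_ball_def)
  have lim: "(\<lambda>p. Y p i) \<longlonglongrightarrow> T i" for i
  proof (rule Lim_null[THEN iffD2], rule Lim_null_comparison)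
    show "\<forall>\<^sub>F p in sequentially. norm (Y p i - T i) \<le> 1 / real (Suc p)"
      using norm_le_tuple_norm[OF op_tuples_diff[OF tuples(2,1)], of _ i] close
      by (intro always_eventually allI) (meson less_imp_le order_trans)
    show "(\<lambda>p. 1 / real (Suc p)) \<longlonglongrightarrow> 0"
      by (rule LIMSEQ_Suc[OF lim_1_over_n])
  qed
  have "(\<lambda>p. tuple_norm (\<lambda>j. free_map a (Y p) j - free_map a T j)) \<longlonglongrightarrow> 0"
  proof (rule tendsto_tuple_norm_zero)
    show "(\<lambda>p. free_map a (Y p) j - free_map a T j) \<longlonglongrightarrow> 0" for j
      unfolding free_map_def
      by (intro Lim_null[THEN iffD1] tendsto_free_eval hol lim tuples ball)
    show "(\<lambda>j. free_map a (Y p) j - free_map a T j) \<in> op_tuples" for p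
      by (simp add: op_tuples_def free_map_def free_eval_complex complex_ops_diff hol Y ball)
  qed
  from order_tendstoD(2)[OF this \<open>\<epsilon> > 0\<close>] far show False
    by simp
qed

theorem corollary5p7:
  fixes a :: "'m::finite \<Rightarrow> 'n::finite list \<Rightarrow> complex"
  assumes "separable_infinite_dimensional TYPE('k::complex_hilbert)"
    and "\<And>j. free_holomorphic (a j)"
    and "contractive TYPE('k) a"
    and "norm (value_at_zero a) < 1"
    and "\<And>j. boundary_in_disc_algebra (a j)"
  shows "free_map a ` (spectral_ball :: ('n \<Rightarrow> 'h::complex_hilbert \<Rightarrow>\<^sub>L 'h) set)
           \<subseteq> (spectral_ball :: ('m \<Rightarrow> 'h \<Rightarrow>\<^sub>L 'h) set)
    \<and> tuple_continuous_on (spectral_ball :: ('n \<Rightarrow> 'h \<Rightarrow>\<^sub>L 'h) set) (free_map a)"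
  using free_map_spectral_ball[OF assms(1,3,2,4)] free_map_continuous[of a, OF assms(2)] by blast

end
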